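(* Let $\zeta:\{0,1\}\to\{0,1\}^*$ be a primitive aperiodic binary substitution of constant length $q\ge 2$ such that $\zeta(0)$ starts with $0$, and let $x=\zeta^\infty(0)$. For $n\ge2$ and $\ell\in\mathbb{N}$, let $b_\ell(n)$ denote the number of $n$-boundary lines $(i,j,\ell_{ij}^n)$ in $\mathcal{R}(x,n,1/2)$ such that $\ell_{ij}=\ell$. Then, for every $\ell\ge1$ and $n\ge2$, $$\ell\, b_\ell(n)<8\varrho n .$$
   Context: $\mathbb{N}$ = positive integers, $\mathbb{N}_0=\mathbb{N}\cup\{0\}$, $A=\{0,1\}$; $y_{[i,j)}=y_i\dots y_{j-1}$ for a sequence $y$. A substitution of constant length $q\ge2$ is a map $\zeta:A\to A^*$ with $|\zeta(0)|=|\zeta(1)|=q$, extended to words and sequences by concatenation. It is primitive if there is $k\ge1$ such that for all $a,b\in A$ the letter $b$ occurs in $\zeta^k(a)$. $\mathcal{L}_\zeta$ is the set of all subwords of the words $\zeta^k(a)$ ($k\ge0$, $a\in A$). $X_\zeta=\{y\in A^{\mathbb{N}_0}: y_{[0,n)}\in\mathcal{L}_\zeta\ \forall n\ge1\}$. $\zeta$ is aperiodic if $X_\zeta$ contains a sequence that is not periodic under the shift (i.e. not of the form $u^\infty$). $x=\zeta^\infty(0)=\lim_k\zeta^k(0)$ is the unique fixed point of $\zeta$ starting with $0$. $\alpha$ (resp. $\beta$) is the length of the longest common prefix (resp. suffix) of $\zeta(0)$ and $\zeta(1)$. A nonempty word $w\in\mathcal{L}_\zeta$ is recognizable if there is a (unique)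 integer $p_w\in[0,q)$ with $\{i\in\mathbb{N}_0: x_{[i,i+|w|)}=w\}\subseteq q\mathbb{N}_0+p_w$. $\varrho\in\mathbb{N}_0$ is the smallest integer such that $\varrho>\alpha+\beta$ and every $w\in\mathcal{L}_\zeta$ of length at least $\varrho$ is recognizable. (Such $\varrho$ exists.) For $n\in\{2,3,\dots\}\cup\{\infty\}$, $\mathcal{R}(x,n,1/2)$ is the $n\times n$ matrix with entries $\mathcal{R}_{ij}$, $0\le i,j<n$, where $\mathcal{R}_{ij}=1$ if $x_i=x_j$ and $\mathcal{R}_{ij}=0$ otherwise. A line of length $\ell\ge1$ in it is a triple of integers $(i,j,\ell)$ with $0\le i,j\le n-\ell$, $i\neq j$, such that $\mathcal{R}_{i+h,j+h}=1$ for every $0\le h<\ell$; if $\min\{i,j\}>0$ then $\mathcal{R}_{i-1,j-1}=0$; and if $\max\{i,j\}<n-\ell$ then $\mathcal{R}_{i+\ell,j+\ell}=0$. The line starts at $(i,j)$; for finite $n$ it is $n$-boundary if $\max\{i,j\}=n-\ell$. For finite $n$ and $0\le i,j<n$, $\ell_{ij}^n$ (resp. $\ell_{ij}$) is the length of the line in $\mathcal{R}(x,n,1/2)$ (resp. in $\mathcal{R}(x,\infty,1/2)$) starting at $(i,j)$, and $0$ if there is no such line. *)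

theory Defs
  imports Complex_Main "HOL-Library.Sublist" "HOL-Library.Extended_Nat" "HOL-Library.Z2"
begin

type_synonym substitution = "bit \<Rightarrow> bit list"

definition subst_word :: "substitution \<Rightarrow> bit list \<Rightarrow> bit list" where
  "subst_word \<zeta> w = concat (map \<zeta> w)"

definition subst_iter :: "substitution \<Rightarrow> nat \<Rightarrow> bit \<Rightarrow> bit list" where
  "subst_iter \<zeta> k a = (subst_word \<zeta> ^^ k) [a]"

definition constant_length :: "substitution \<Rightarrow> nat \<Rightarrow> bool" where
  "constant_length \<zeta> q \<longleftrightarrow> (\<forall>a. length (\<zeta> a) = q)"

definition primitive :: "substitution \<Rightarrow> bool" where
  "primitive \<zeta> \<longleftrightarrow> (\<exists>k\<ge>1. \<forall>a b. b \<in> set (subst_iter \<zeta> k a))"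

definition language :: "substitution \<Rightarrow> bit list set" where
  "language \<zeta> = {w. \<exists>k a. sublist w (subst_iter \<zeta> k a)}"

text \<open>The word \<open>y\<^sub>i \<dots> y\<^sub>j\<^sub>-\<^sub>1\<close>.\<close>

definition subword :: "(nat \<Rightarrow> 'a) \<Rightarrow> nat \<Rightarrow> nat \<Rightarrow> 'a list" where
  "subword y i j = map y [i..<j]"

definition subst_space :: "substitution \<Rightarrow> (nat \<Rightarrow> bit) set" where
  "subst_space \<zeta> = {y. \<forall>n\<ge>1. subword y 0 n \<in> language \<zeta>}"

text \<open>Purely periodic, that is, of the form \<open>u u u \<dots>\<close> for a nonempty word \<open>u\<close>.\<close>

definition periodic :: "(nat \<Rightarrow> 'a) \<Rightarrow> bool" where
  "periodic y \<longleftrightarrow> (\<exists>p\<ge>1. \<forall>i. y (i + p) = y i)"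

definition aperiodic :: "substitution \<Rightarrow> bool" where
  "aperiodic \<zeta> \<longleftrightarrow> (\<exists>y \<in> subst_space \<zeta>. \<not> periodic y)"

text \<open>
  The limit of the words \<open>\<zeta>\<^sup>k(0)\<close>, taken letter by letter. It exists when \<open>\<zeta>\<close> has
  constant length at least 2 and \<open>\<zeta>(0)\<close> starts with 0.
\<close>

definition fixed_point :: "substitution \<Rightarrow> nat \<Rightarrow> bit" where
  "fixed_point \<zeta> i = (THE a. \<forall>\<^sub>F k in sequentially.
     i < length (subst_iter \<zeta> k 0) \<and> subst_iter \<zeta> k 0 ! i = a)"

definition common_prefix_length :: "substitution \<Rightarrow> nat" where
  "common_prefix_length \<zeta> = length (longest_common_prefix (\<zeta> 0) (\<zeta> 1))"

definition common_suffix_length :: "substitution \<Rightarrow> nat" where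
  "common_suffix_length \<zeta> = length (longest_common_prefix (rev (\<zeta> 0)) (rev (\<zeta> 1)))"

definition recognizable :: "substitution \<Rightarrow> nat \<Rightarrow> bit list \<Rightarrow> bool" where
  "recognizable \<zeta> q w \<longleftrightarrow> w \<noteq> [] \<and> w \<in> language \<zeta> \<and>
     (\<exists>p<q. {i. subword (fixed_point \<zeta>) i (i + length w) = w} \<subseteq> {q * m + p | m. True})"

text \<open>The least such number exists for every primitive aperiodic \<open>\<zeta>\<close> of constant length
  at least 2 with \<open>\<zeta>(0)\<close> starting with 0.\<close>

definition recognizability_const :: "substitution \<Rightarrow> nat \<Rightarrow> nat" where
  "recognizability_const \<zeta> q = (LEAST r.
     r > common_prefix_length \<zeta> + common_suffix_length \<zeta> \<and>
     (\<forall>w \<in> language \<zeta>. length w \<ge> r \<longrightarrow> recognizable \<zeta> q w))"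

text \<open>
  Entries of the recurrence matrix with threshold \<open>1/2\<close>. An entry does not depend on the size
  \<open>n\<close> of the matrix; the size enters through the index bounds in the definition of a line.
\<close>

definition recurrence :: "(nat \<Rightarrow> 'a) \<Rightarrow> nat \<Rightarrow> nat \<Rightarrow> nat" where
  "recurrence x i j = (if x i = x j then 1 else 0)"

text \<open>Bounds such as \<open>i \<le> n - l\<close> are written as \<open>i + l \<le> n\<close> to avoid truncated subtraction.\<close>

definition is_line :: "(nat \<Rightarrow> 'a) \<Rightarrow> enat \<Rightarrow> nat \<Rightarrow> nat \<Rightarrow> nat \<Rightarrow> bool" where
  "is_line x n i j l \<longleftrightarrow> l \<ge> 1 \<and> enat (i + l) \<le> n \<and> enat (j + l) \<le> n \<and> i \<noteq> j \<and>
     (\<forall>h<l. recurrence x (i + h) (j + h) = 1) \<and>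
     (min i j > 0 \<longrightarrow> recurrence x (i - 1) (j - 1) = 0) \<and>
     (enat (max i j + l) < n \<longrightarrow> recurrence x (i + l) (j + l) = 0)"

definition line_length :: "(nat \<Rightarrow> 'a) \<Rightarrow> enat \<Rightarrow> nat \<Rightarrow> nat \<Rightarrow> nat" where
  "line_length x n i j = (if \<exists>l. is_line x n i j l then THE l. is_line x n i j l else 0)"

definition boundary_line :: "(nat \<Rightarrow> 'a) \<Rightarrow> nat \<Rightarrow> nat \<Rightarrow> nat \<Rightarrow> nat \<Rightarrow> bool" where
  "boundary_line x n i j l \<longleftrightarrow> is_line x (enat n) i j l \<and> max i j + l = n"

definition boundary_count :: "(nat \<Rightarrow> 'a) \<Rightarrow> nat \<Rightarrow> nat \<Rightarrow> nat" where
  "boundary_count x l n = card {(i, j, line_length x (enat n) i j) | i j.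
     boundary_line x n i j (line_length x (enat n) i j) \<and> line_length x \<infinity> i j = l}"

end

theory Submission
  imports Defs
begin

text \<open>
  By symmetry it suffices to count pairs \<open>i < j\<close> that start a line of length \<open>l\<close> with \<open>j\<close> in the
  window \<open>[n - l, n)\<close>. Recognizability desubstitutes lines of length at least \<open>\<rho>\<close>: away from the
  border \<open>i = 0\<close> a line of length \<open>l = q l' + \<alpha> + \<beta>\<close> at \<open>(i, j)\<close> comes from a line of length \<open>l'\<close>
  at \<open>((i + \<beta>) / q, (j + \<beta>) / q)\<close>. Iterating, lines of length \<open>l\<close> inject into the lines of some
  length \<open>m < \<rho>\<close> inside a square of size about \<open>n / q\<^sup>k\<close>, where \<open>l < q\<^sup>k (m + 1)\<close>.

  There the number of lines is at most three times the size \<open>M\<close> of the square. Indeed, the lines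
  \<open>(i, j)\<close> fall into classes \<open>A \<times> C\<close> according to the word of length \<open>m + 2\<close> around \<open>i\<close>, which
  determines the one around \<open>j\<close> because the alphabet is binary. If \<open>e\<close> is the least gap of \<open>C\<close>,
  then the common word has period \<open>e\<close>, and all gaps in \<open>A\<close> and all distances from \<open>A\<close> to \<open>C\<close>
  exceed \<open>m - e\<close>, since the letters adjacent to the word would otherwise agree. This makes \<open>A\<close>
  sparse when \<open>C\<close> has at least three elements, while smaller \<open>C\<close> contribute at most \<open>2M\<close> in total.
  The lines with \<open>i = 0\<close> contribute fewer than \<open>\<rho> n / l\<close>.
\<close>

section \<open>Counting maximal matches in a binary sequence\<close>

text \<open>For \<open>l > 0\<close> these are the lines of the infinite matrix off its border.
  Positivity makes \<open>i - 1\<close> and \<open>j - 1\<close> true predecessors; border lines are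
  left to \<open>initial_match\<close>.\<close>

definition maximal_match :: "(nat \<Rightarrow> bit) \<Rightarrow> nat \<Rightarrow> nat \<Rightarrow> nat \<Rightarrow> bool" where
  "maximal_match x l i j \<longleftrightarrow> 0 < i \<and> 0 < j \<and> x (i - 1) \<noteq> x (j - 1) \<and>
     (\<forall>h<l. x (i + h) = x (j + h)) \<and> x (i + l) \<noteq> x (j + l)"

lemma bit_eqI: "a \<noteq> c \<Longrightarrow> b \<noteq> c \<Longrightarrow> a = b" for a b c :: bit
  by (cases a; cases b; cases c) auto

text \<open>Two letters that both differ from a third one agree, as there are only two. This makes
  partner sets equal or disjoint.\<close>

lemma maximal_match_trans:
  assumes "maximal_match x l i j" "maximal_match x l i' j" "maximal_match x l i k"
  shows "maximal_match x l i' k"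
  using assms unfolding maximal_match_def
  by (metis (full_types) bit_eqI)

text \<open>The word \<open>f\<close> has the periods \<open>d\<close> and \<open>e\<close>, and
  \<open>d + e \<le> l\<close> leaves room to apply both: the letters before the later occurrences
  are \<open>f (d + e - 1)\<close>, those after the earlier ones
  \<open>f (l - (d + e))\<close>.\<close>

lemma overlapping_occurrences:
  fixes x :: "nat \<Rightarrow> 'a"
  assumes "\<And>h. h < l \<Longrightarrow> x (s + h) = f h" "\<And>h. h < l \<Longrightarrow> x (s + d + h) = f h"
    and "\<And>h. h < l \<Longrightarrow> x (t + h) = f h" "\<And>h. h < l \<Longrightarrow> x (t + e + h) = f h"
    and "0 < d" "0 < e" "d + e \<le> l"
  shows "x (s + d - 1) = x (t + e - 1)" "x (s + l) = x (t + l)"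
proof -
  have "x (s + d - 1) = f (d + e - 1)"
    using assms(1)[of "d - 1"] assms(4)[of "d - 1"] assms(3)[of "d + e - 1"] assms(5-7)
    by (simp add: algebra_simps)
  moreover have "x (t + e - 1) = f (d + e - 1)"
    using assms(3)[of "e - 1"] assms(2)[of "e - 1"] assms(1)[of "d + e - 1"] assms(5-7)
    by (simp add: algebra_simps)
  ultimately show "x (s + d - 1) = x (t + e - 1)" by simp
  have "x (s + l) = f (l - (d + e))"
    using assms(2)[of "l - d"] assms(3)[of "l - d"] assms(4)[of "l - (d + e)"] assms(5-7)
    by (simp add: algebra_simps)
  moreover have "x (t + l) = f (l - (d + e))"
    using assms(4)[of "l - e"] assms(1)[of "l - e"] assms(2)[of "l - (d + e)"] assms(5-7)
    by (simp add: algebra_simps)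
  ultimately show "x (s + l) = x (t + l)" by simp
qed

lemma spaced_card_le:
  fixes S :: "nat set"
  assumes "finite S" "L \<le> U"
    and gap: "\<And>a b. a \<in> S \<Longrightarrow> b \<in> S \<Longrightarrow> a < b \<Longrightarrow> a + p \<le> b"
    and bnd: "\<And>a. a \<in> S \<Longrightarrow> L \<le> a \<and> a + p \<le> U"
  shows "card S * p + L \<le> U"
proof -
  have disj: "{a..<a + p} \<inter> {b..<b + p} = {}" if "a \<in> S" "b \<in> S" "a \<noteq> b" for a b
    using gap[of a b] gap[of b a] that by (cases "a < b") auto
  have "card S * p = card (\<Union>a\<in>S. {a..<a + p})"
    using disj assms(1) by (subst card_UN_disjoint) auto
  also have "\<dots> \<le> card {L..<U}"
    using bnd by (intro card_mono) fastforce+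
  finally show ?thesis using assms(2) by simp
qed

lemma min_gap_exists:
  fixes C :: "nat set"
  assumes "2 \<le> card C"
  obtains e a where "0 < e" "a \<in> C" "a + e \<in> C"
    "\<And>b c. b \<in> C \<Longrightarrow> c \<in> C \<Longrightarrow> b < c \<Longrightarrow> b + e \<le> c"
proof -
  define P where "P e \<longleftrightarrow> 0 < e \<and> (\<exists>a\<in>C. a + e \<in> C)" for e
  have "\<exists>b\<in>C. \<exists>c\<in>C. b \<noteq> c"
    using assms by (metis card_le_Suc0_iff_eq card.infinite not_less_eq_eq numeral_2_eq_2 not_numeral_le_zero)
  then obtain b c where "b \<in> C" "c \<in> C" "b < c"
    by (metis linorder_neqE_nat)
  then have "P (c - b)" unfolding P_def by force
  then have least: "P (LEAST e. P e)" by (rule LeastI)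
  moreover have "b + (LEAST e. P e) \<le> c" if "b \<in> C" "c \<in> C" "b < c" for b c
  proof -
    have "P (c - b)" unfolding P_def using that by force
    then have "(LEAST e. P e) \<le> c - b" by (rule Least_le)
    then show ?thesis using that by simp
  qed
  ultimately show thesis using that unfolding P_def by blast
qed

text \<open>For the least gap \<open>e\<close> of \<open>C\<close> the window gives
  \<open>(card C - 1) * e \<le> l\<close>, while \<open>A\<close> lies below \<open>C\<close> with
  gaps at least \<open>l + 1 - e\<close>. The factor \<open>card C\<close> on the right can be
  summed over disjoint classes.\<close>

lemma card_match_class_le:
  assumes "finite A" and C: "3 \<le> card C"
    and window: "\<And>j j'. j \<in> C \<Longrightarrow> j' \<in> C \<Longrightarrow> j' \<le> j + l"
    and match: "\<And>i j. i \<in> A \<Longrightarrow> j \<in> C \<Longrightarrow> maximal_match x l i j"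
    and above: "\<And>i. i \<in> A \<Longrightarrow> \<exists>j\<in>C. i < j"
    and bound: "\<And>j. j \<in> C \<Longrightarrow> j \<le> M + 1"
  shows "(l + 1) * (card A * (card C - 2)) \<le> M * card C"
proof (cases "A = {}")
  case False
  have finC: "finite C" and neC: "C \<noteq> {}" using C card.infinite by force+
  obtain e a where e: "0 < e" "a \<in> C" "a + e \<in> C"
    and gapC: "\<And>b c. b \<in> C \<Longrightarrow> c \<in> C \<Longrightarrow> b < c \<Longrightarrow> b + e \<le> c"
    using min_gap_exists[of C] C by (metis One_nat_def Suc_1 Suc_leD numeral_3_eq_3)
  define c where "c = Min C"
  have c: "c \<in> C" "\<And>j. j \<in> C \<Longrightarrow> c \<le> j" unfolding c_def using finC neC by auto
  \<comment> \<open>The interval of length \<open>e\<close> after the largest element of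
    \<open>C\<close> may leave the window, hence the extra \<open>e\<close>.\<close>
  have "card C * e + c \<le> c + l + e"
    by (rule spaced_card_le) (use finC gapC c window in auto)
  then have Ce: "card C * e \<le> l + e" by simp
  have "3 * e \<le> card C * e" using C by simp
  then have e2: "2 * e \<le> l" using Ce by linarith
  \<comment> \<open>A distance below \<open>p\<close> and the period \<open>e\<close> add up to at
    most \<open>l\<close>, as \<open>overlapping_occurrences\<close> requires.\<close>
  define p where "p = l + 1 - e"
  have p: "p + e = l + 1" unfolding p_def using e2 by simp
  have eq: "x (k + h) = x (a + h)" if "k \<in> A \<or> k \<in> C" "h < l" for k h
  proof -
    have A_eq: "x (i + h) = x (j + h)" if "i \<in> A" "j \<in> C" for i j
      using match[OF that] \<open>h < l\<close> unfolding maximal_match_def by blast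
    obtain i where "i \<in> A" using False by blast
    show ?thesis using that(1)
    proof
      assume "k \<in> A"
      then show ?thesis using A_eq e(2) by blast
    next
      assume "k \<in> C"
      then show ?thesis using A_eq[OF \<open>i \<in> A\<close>] e(2) by metis
    qed
  qed
  have gap_below: "j + p \<le> i" if "i \<in> A" "j \<in> C" "j < i" for i j
  proof (rule ccontr)
    assume near: "\<not> j + p \<le> i"
    have "x (j + (i - j) - 1) = x (a + e - 1)"
      by (rule overlapping_occurrences(1)[where f = "\<lambda>h. x (a + h)" and l = l and d = "i - j" and e = e])
        (use that e p near in \<open>auto intro: eq\<close>)
    moreover have "x (i - 1) \<noteq> x (a + e - 1)"
      using match[OF that(1) e(3)] unfolding maximal_match_def by simp
    ultimately show False using that by simp
  qed
  have gap_above: "i + p \<le> j" if "i \<in> A" "j \<in> C" "i < j" for i j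
  proof (rule ccontr)
    assume near: "\<not> i + p \<le> j"
    have "x (i + l) = x (a + l)"
      by (rule overlapping_occurrences(2)[where f = "\<lambda>h. x (a + h)" and l = l and d = "j - i" and e = e])
        (use that e p near in \<open>auto intro: eq\<close>)
    moreover have "x (i + l) \<noteq> x (a + l)"
      using match[OF that(1) e(2)] unfolding maximal_match_def by simp
    ultimately show False by simp
  qed
  have gapA: "i + p \<le> i'" if "i \<in> A" "i' \<in> A" "i < i'" for i i'
  proof (rule ccontr)
    assume near: "\<not> i + p \<le> i'"
    have "x (i + (i' - i) - 1) = x (a + e - 1)"
      by (rule overlapping_occurrences(1)[where f = "\<lambda>h. x (a + h)" and l = l and d = "i' - i" and e = e])
        (use that e p near in \<open>auto intro: eq\<close>)
    moreover have "x (i' - 1) \<noteq> x (a + e - 1)"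
      using match[OF that(2) e(3)] unfolding maximal_match_def by simp
    ultimately show False using that by simp
  qed
  \<comment> \<open>An \<open>i\<close> between two elements of \<open>C\<close> would need
    \<open>2 * p\<close> positions in a window of length \<open>l\<close>, but
    \<open>2 * e \<le> l\<close> makes \<open>2 * p\<close> exceed \<open>l\<close>.\<close>
  have below: "i + p \<le> c" if i: "i \<in> A" for i
  proof -
    obtain j where j: "j \<in> C" "i < j" using above[OF i] by blast
    have "\<not> c < i"
    proof
      assume "c < i"
      then have "c + p + p \<le> j" using gap_below[OF i c(1)] gap_above[OF i j] by linarith
      then show False using window[OF c(1) j(1)] p e2 e(1) by linarith
    qed
    moreover have "i \<noteq> c" using match[OF i c(1)] unfolding maximal_match_def by auto
    ultimately show ?thesis using gap_above[OF i c(1)] by simp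
  qed
  have pos: "1 \<le> i" if "i \<in> A" for i
    using match[OF that c(1)] unfolding maximal_match_def by simp
  have "1 \<le> c" using False match[OF _ c(1)] unfolding maximal_match_def by fastforce
  then have "card A * p + 1 \<le> c"
    by (intro spaced_card_le) (use assms(1) gapA below pos in auto)
  then have Ap: "card A * p \<le> M" using bound[OF c(1)] by linarith
  define k where "k = card C - 2"
  have k: "card C = k + 2" unfolding k_def using C by simp
  \<comment> \<open>Here \<open>(k + 1) * p\<close> is \<open>(k + 1) * (l + 1)\<close> minus
    \<open>(k + 1) * e\<close>, which is less than \<open>l + 1\<close>.\<close>
  have "(k + 1) * e \<le> l" using Ce unfolding k by (simp add: algebra_simps)
  moreover have "(k + 1) * (p + e) = (k + 1) * (l + 1)" unfolding p ..
  ultimately have "(l + 1) * k \<le> (k + 1) * p" by (simp add: algebra_simps)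
  then have "card A * ((l + 1) * k) \<le> card A * ((k + 1) * p)" by (rule mult_le_mono2)
  also have "\<dots> = (k + 1) * (card A * p)" by (rule mult.left_commute)
  also have "\<dots> \<le> (k + 2) * M" by (rule mult_le_mono) (use Ap in auto)
  finally show ?thesis unfolding k by (simp add: algebra_simps)
qed simp

text \<open>Counting at most two partners per \<open>i\<close> gives \<open>2 * M\<close>. The
  excess is summed by classes; distinct partner sets are disjoint and share at most
  \<open>l + 1\<close> values of \<open>j\<close>, so it adds at most \<open>M\<close>.\<close>

lemma card_maximal_matches_le:
  assumes "finite S"
    and S: "\<And>i j. (i, j) \<in> S \<Longrightarrow> i < j \<and> j \<le> M + 1 \<and> maximal_match x l i j"
    and window: "\<And>i j i' j'. (i, j) \<in> S \<Longrightarrow> (i', j') \<in> S \<Longrightarrow> j' \<le> j + l"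
  shows "card S \<le> 3 * M"
proof (cases "S = {}")
  case False
  define I where "I = fst ` S"
  define J where "J = snd ` S"
  define partners where "partners i = {j \<in> J. maximal_match x l i j}" for i
  define big where "big = {i \<in> I. 3 \<le> card (partners i)}"
  have fin: "finite I" "finite J" "finite big" "\<And>i. finite (partners i)"
    using assms(1) unfolding I_def J_def big_def partners_def by auto
  have "I \<subseteq> {1..M}"
  proof
    fix i assume "i \<in> I"
    then obtain j where "(i, j) \<in> S" unfolding I_def by auto
    then show "i \<in> {1..M}" using S[of i j] unfolding maximal_match_def by auto
  qed
  then have cardI: "card I \<le> M" by (metis card_mono finite_atLeastAtMost card_atLeastAtMost diff_Suc_1)
  have winJ: "j' \<le> j + l" if "j \<in> J" "j' \<in> J" for j j'
    using that window unfolding J_def by auto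
  have "J \<noteq> {}" using False unfolding J_def by simp
  then have "Min J \<in> J" using fin by simp
  then have "J \<subseteq> {Min J..Min J + l}" using winJ fin by auto
  then have "card J \<le> card {Min J..Min J + l}" by (rule card_mono[rotated]) simp
  then have cardJ: "card J \<le> l + 1" by simp
  have share: "partners i = partners i'" if "j \<in> partners i" "j \<in> partners i'" for i i' j
    using that maximal_match_trans[of x l] unfolding partners_def by blast
  have "S \<subseteq> Sigma I partners"
    unfolding I_def J_def partners_def using S by force
  then have "card S \<le> card (Sigma I partners)" using fin by (intro card_mono) auto
  also have "\<dots> = (\<Sum>i\<in>I. card (partners i))" using fin by simp
  also have "\<dots> \<le> (\<Sum>i\<in>I. 2 + (if i \<in> big then card (partners i) - 2 else 0))"
    by (rule sum_mono) (auto simp: big_def)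
  also have "\<dots> = 2 * card I + (\<Sum>i\<in>big. card (partners i) - 2)"
    using fin unfolding sum.distrib by (subst sum.If_cases) (auto simp: big_def intro!: sum.cong)
  finally have 1: "card S \<le> 2 * M + (\<Sum>i\<in>big. card (partners i) - 2)" using cardI by linarith
  define fibre where "fibre C = {i \<in> big. partners i = C}" for C
  have "(l + 1) * (\<Sum>i\<in>big. card (partners i) - 2)
      = (l + 1) * (\<Sum>C\<in>partners ` big. \<Sum>i\<in>fibre C. card (partners i) - 2)"
    unfolding fibre_def using fin by (subst sum.image_gen[of big _ partners]) auto
  also have "\<dots> = (\<Sum>C\<in>partners ` big. (l + 1) * (card (fibre C) * (card C - 2)))"
    unfolding fibre_def by (simp add: sum_distrib_left)
  also have "\<dots> \<le> (\<Sum>C\<in>partners ` big. M * card C)"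
  proof (rule sum_mono, rule card_match_class_le)
    fix C assume "C \<in> partners ` big"
    then have "C \<subseteq> J" "3 \<le> card C" unfolding big_def partners_def by auto
    then show "3 \<le> card C" "\<And>j j'. j \<in> C \<Longrightarrow> j' \<in> C \<Longrightarrow> j' \<le> j + l" using winJ by auto
    show "finite (fibre C)" using fin unfolding fibre_def by simp
    show "maximal_match x l i j" if "i \<in> fibre C" "j \<in> C" for i j
      using that unfolding fibre_def partners_def by auto
    show "\<exists>j\<in>C. i < j" if "i \<in> fibre C" for i
    proof -
      have "i \<in> I" and C: "C = partners i" using that unfolding fibre_def big_def by auto
      then obtain j where "(i, j) \<in> S" unfolding I_def by auto
      then show ?thesis using S[of i j] unfolding C partners_def J_def by force
    qed
    show "j \<le> M + 1" if "j \<in> C" for j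
      using that \<open>C \<subseteq> J\<close> S unfolding J_def by auto
  qed
  also have "\<dots> = M * card (\<Union> (partners ` big))"
  proof -
    have "card (\<Union> (partners ` big)) = (\<Sum>C\<in>partners ` big. card C)"
      using fin by (intro card_Union_disjoint) (auto simp: pairwise_def disjnt_def dest: share)
    then show ?thesis by (simp add: sum_distrib_left)
  qed
  also have "\<dots> \<le> M * (l + 1)"
  proof -
    have "card (\<Union> (partners ` big)) \<le> card J"
      using fin by (intro card_mono) (auto simp: partners_def)
    then show ?thesis using cardJ by (intro mult_le_mono2) linarith
  qed
  finally have "(l + 1) * (\<Sum>i\<in>big. card (partners i) - 2) \<le> (l + 1) * M"
    by (simp add: mult.commute)
  then have "(\<Sum>i\<in>big. card (partners i) - 2) \<le> M" unfolding mult_le_cancel1 by simp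
  then show ?thesis using 1 by linarith
qed simp

section \<open>The fixed point\<close>

lemma nth_concat_const_length:
  assumes "\<And>xs. xs \<in> set xss \<Longrightarrow> length xs = q" "i < length xss" "r < q"
  shows "concat xss ! (q * i + r) = xss ! i ! r"
  using assms
proof (induction xss arbitrary: i)
  case (Cons xs xss)
  then show ?case by (cases i) (auto simp: nth_append)
qed simp

lemma length_longest_common_prefix_least:
  assumes "length u = length v" "r < length u" "u ! r \<noteq> v ! r" "\<And>h. h < r \<Longrightarrow> u ! h = v ! h"
  shows "length (longest_common_prefix u v) = r"
  using assms
proof (induction u v arbitrary: r rule: longest_common_prefix.induct)
  case (1 x xs y ys)
  show ?case
  proof (cases r)
    case 0
    then show ?thesis using 1 by simp
  next
    case (Suc r')
    have "length (longest_common_prefix xs ys) = r'"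
    proof (rule "1.IH")
      show "x = y" using "1.prems"(4)[of 0] Suc by simp
      show "xs ! h = ys ! h" if "h < r'" for h
        using "1.prems"(4)[of "Suc h"] Suc that by simp
    qed (use "1.prems" Suc in auto)
    moreover have "x = y" using "1.prems"(4)[of 0] Suc by simp
    ultimately show ?thesis unfolding Suc by simp
  qed
qed (metis list.size(3) not_less_zero)+

locale prolongable_subst =
  fixes \<zeta> :: substitution and q :: nat
  assumes q_ge_2: "2 \<le> q"
    and constant_length: "constant_length \<zeta> q"
    and hd_zero: "hd (\<zeta> 0) = 0"
begin

abbreviation x :: "nat \<Rightarrow> bit" where
  "x \<equiv> fixed_point \<zeta>"

lemma length_image [simp]: "length (\<zeta> a) = q"
  using constant_length unfolding constant_length_def by simp

lemma q_pos [simp]: "0 < q"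
  using q_ge_2 by simp

lemma length_subst_word: "length (subst_word \<zeta> w) = q * length w"
  unfolding subst_word_def by (induction w) auto

lemma nth_subst_word:
  assumes "i < length w" "r < q"
  shows "subst_word \<zeta> w ! (q * i + r) = \<zeta> (w ! i) ! r"
  unfolding subst_word_def using assms by (subst nth_concat_const_length[of _ q]) auto

lemma subst_iter_0 [simp]: "subst_iter \<zeta> 0 a = [a]"
  unfolding subst_iter_def by simp

lemma subst_iter_Suc: "subst_iter \<zeta> (Suc k) a = subst_word \<zeta> (subst_iter \<zeta> k a)"
  unfolding subst_iter_def by simp

lemma length_subst_iter [simp]: "length (subst_iter \<zeta> k a) = q ^ k"
  by (induction k) (auto simp: subst_iter_Suc length_subst_word)

lemma nth_subst_iter_Suc:
  assumes "i < q ^ k" "r < q"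
  shows "subst_iter \<zeta> (Suc k) a ! (q * i + r) = \<zeta> (subst_iter \<zeta> k a ! i) ! r"
  using assms by (simp add: subst_iter_Suc nth_subst_word)

lemma div_less_power:
  assumes "i < q ^ Suc k"
  shows "i div q < q ^ k"
  using assms by (simp add: less_mult_imp_div_less mult.commute)

lemma less_power_mono:
  assumes "i < q ^ k" "k \<le> m"
  shows "i < q ^ m"
  using assms power_increasing[of k m q] q_ge_2 by linarith

lemma subst_iter_prefix_Suc:
  assumes "i < q ^ k"
  shows "subst_iter \<zeta> (Suc k) 0 ! i = subst_iter \<zeta> k 0 ! i"
  using assms
proof (induction k arbitrary: i)
  case 0
  have "\<zeta> 0 ! 0 = 0"
    using hd_zero q_pos by (metis hd_conv_nth length_image length_0_conv less_irrefl)
  then show ?case using 0 nth_subst_iter_Suc[of 0 0 0 0] by simp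
next
  case (Suc k)
  have less: "i div q < q ^ k" using Suc.prems by (rule div_less_power)
  then have less': "i div q < q ^ Suc k" using q_ge_2 by (intro less_power_mono[OF less]) simp
  have r: "i mod q < q" by simp
  have "subst_iter \<zeta> (Suc (Suc k)) 0 ! (q * (i div q) + i mod q)
      = subst_iter \<zeta> (Suc k) 0 ! (q * (i div q) + i mod q)"
    unfolding nth_subst_iter_Suc[OF less' r] nth_subst_iter_Suc[OF less r] Suc.IH[OF less] ..
  then show ?case unfolding mult_div_mod_eq .
qed

lemma subst_iter_prefix:
  assumes "i < q ^ k" "k \<le> m"
  shows "subst_iter \<zeta> m 0 ! i = subst_iter \<zeta> k 0 ! i"
  using assms(2)
proof (induction m rule: dec_induct)
  case (step m)
  then show ?case using subst_iter_prefix_Suc[OF less_power_mono[OF assms(1) step(1)]] by metis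
qed simp

lemma less_power: "i < q ^ i"
  using q_ge_2 by (metis less_exp order_less_le_trans power_mono zero_le)

lemma fixed_point_eq:
  assumes "i < q ^ k"
  shows "x i = subst_iter \<zeta> k 0 ! i"
  unfolding fixed_point_def
proof (rule the_equality)
  have "\<forall>m\<ge>k. i < length (subst_iter \<zeta> m 0) \<and> subst_iter \<zeta> m 0 ! i = subst_iter \<zeta> k 0 ! i"
    by (intro allI impI conjI subst_iter_prefix[OF assms]) (simp_all add: less_power_mono[OF assms])
  then show ev: "\<forall>\<^sub>F m in sequentially. i < length (subst_iter \<zeta> m 0) \<and>
      subst_iter \<zeta> m 0 ! i = subst_iter \<zeta> k 0 ! i"
    unfolding eventually_sequentially by blast
  fix a
  assume "\<forall>\<^sub>F m in sequentially. i < length (subst_iter \<zeta> m 0) \<and> subst_iter \<zeta> m 0 ! i = a"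
  with ev have "\<forall>\<^sub>F m in sequentially. a = subst_iter \<zeta> k 0 ! i"
    by eventually_elim simp
  then show "a = subst_iter \<zeta> k 0 ! i" by simp
qed

lemma fixed_point_image:
  assumes "r < q"
  shows "x (q * a + r) = \<zeta> (x a) ! r"
proof -
  have "q * a + r < q * q ^ a"
  proof -
    have "q * a + r < q * (a + 1)" using assms by simp
    also have "\<dots> \<le> q * q ^ a" using less_power[of a] by (intro mult_le_mono2) simp
    finally show ?thesis .
  qed
  then have "x (q * a + r) = subst_iter \<zeta> (Suc a) 0 ! (q * a + r)"
    by (intro fixed_point_eq) simp
  also have "\<dots> = \<zeta> (x a) ! r"
    using nth_subst_iter_Suc[OF less_power assms] fixed_point_eq[OF less_power] by simp
  finally show ?thesis .
qed

lemma fixed_point_at: "x i = \<zeta> (x (i div q)) ! (i mod q)"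
  using fixed_point_image[of "i mod q" "i div q"] by simp

lemma fixed_point_iter_image:
  assumes "r < q ^ k"
  shows "x (q ^ k * a + r) = subst_iter \<zeta> k (x a) ! r"
  using assms
proof (induction k arbitrary: r)
  case (Suc k)
  have less: "r div q < q ^ k" using Suc.prems by (rule div_less_power)
  have "q ^ Suc k * a + r = q * (q ^ k * a + r div q) + r mod q"
    by (simp add: algebra_simps)
  then have "x (q ^ Suc k * a + r) = \<zeta> (x (q ^ k * a + r div q)) ! (r mod q)"
    using fixed_point_image by simp
  also have "\<dots> = subst_iter \<zeta> (Suc k) (x a) ! (q * (r div q) + r mod q)"
    using Suc.IH[OF less] nth_subst_iter_Suc[OF less, of "r mod q"] q_pos
    by (metis mod_less_divisor)
  finally show ?case by simp
qed simp

end

section \<open>Uniform recurrence\<close>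

lemma finite_UNIV_bit: "finite (UNIV :: bit set)"
proof -
  have "(UNIV :: bit set) = {0, 1}" by (auto intro: bit.exhaust)
  then show ?thesis by (metis finite.emptyI finite.insertI)
qed

context prolongable_subst
begin

text \<open>Position \<open>q ^ k * c + t\<close> lies in the image of letter
  \<open>c + t div q ^ k\<close>, at an offset independent of \<open>c\<close>; \<open>t\<close> may
  run over many blocks.\<close>

lemma iter_image_cong:
  assumes "x (p + t div q ^ k) = x (a + t div q ^ k)"
  shows "x (q ^ k * p + t) = x (q ^ k * a + t)"
proof -
  have split: "q ^ k * c + t = q ^ k * (c + t div q ^ k) + t mod q ^ k" for c
    by (simp add: algebra_simps)
  have "t mod q ^ k < q ^ k" using q_pos by simp
  then show ?thesis
    unfolding split[of p] split[of a] by (simp only: fixed_point_iter_image assms)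
qed

lemma iter_image_cong_word:
  assumes "\<And>h. h < N \<Longrightarrow> x (p + h) = x (a + h)" "t < q ^ k * N"
  shows "x (q ^ k * p + t) = x (q ^ k * a + t)"
  using assms by (intro iter_image_cong assms(1)) (simp add: less_mult_imp_div_less mult.commute)

lemma subst_iter_distinct:
  assumes "\<zeta> 0 \<noteq> \<zeta> 1"
  shows "\<exists>i<q ^ k. subst_iter \<zeta> k 0 ! i \<noteq> subst_iter \<zeta> k 1 ! i"
proof (induction k)
  case (Suc k)
  then obtain i where i: "i < q ^ k" "subst_iter \<zeta> k 0 ! i \<noteq> subst_iter \<zeta> k 1 ! i" by blast
  then have "\<zeta> (subst_iter \<zeta> k 0 ! i) \<noteq> \<zeta> (subst_iter \<zeta> k 1 ! i)"
    using assms by (metis (full_types) bit_not_one_iff)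
  then obtain r where r: "r < q" "\<zeta> (subst_iter \<zeta> k 0 ! i) ! r \<noteq> \<zeta> (subst_iter \<zeta> k 1 ! i) ! r"
    using nth_equalityI[of "\<zeta> (subst_iter \<zeta> k 0 ! i)" "\<zeta> (subst_iter \<zeta> k 1 ! i)"] by auto
  have "q * i + r < q * (i + 1)" using r by simp
  also have "\<dots> \<le> q * q ^ k" using i by (intro mult_le_mono2) simp
  finally show ?case
    using nth_subst_iter_Suc[OF i(1) r(1)] r(2) by (intro exI[of _ "q * i + r"]) simp
qed simp

lemma iter_image_inj:
  assumes "\<zeta> 0 \<noteq> \<zeta> 1" "\<And>t. t < q ^ k * N \<Longrightarrow> x (q ^ k * p + t) = x (q ^ k * a + t)" "h < N"
  shows "x (p + h) = x (a + h)"
proof (rule ccontr)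
  assume neq: "x (p + h) \<noteq> x (a + h)"
  have "subst_iter \<zeta> k (x (p + h)) ! i = subst_iter \<zeta> k (x (a + h)) ! i" if "i < q ^ k" for i
  proof -
    have "q ^ k * h + i < q ^ k * (h + 1)" using that by simp
    also have "\<dots> \<le> q ^ k * N" using assms(3) by (intro mult_le_mono2) simp
    finally have "x (q ^ k * (p + h) + i) = x (q ^ k * (a + h) + i)"
      using assms(2)[of "q ^ k * h + i"] by (simp add: algebra_simps)
    then show ?thesis using fixed_point_iter_image[OF that] by simp
  qed
  then show False
    using neq subst_iter_distinct[OF assms(1), of k] by (metis (full_types) bit_not_one_iff)
qed

end

locale primitive_subst = prolongable_subst +
  assumes primitive: "primitive \<zeta>"
begin

lemma letter_occurs: "\<exists>p. x p = c"
proof -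
  obtain k where "c \<in> set (subst_iter \<zeta> k 0)" using primitive unfolding primitive_def by blast
  then obtain p where "p < q ^ k" "subst_iter \<zeta> k 0 ! p = c" by (auto simp: in_set_conv_nth)
  then show ?thesis using fixed_point_eq by blast
qed

text \<open>By primitivity both letters occur in \<open>x\<close>, hence so do all their iterated
  images.\<close>

lemma language_iff: "w \<in> language \<zeta> \<longleftrightarrow> (\<exists>a. w = subword x a (a + length w))"
proof
  assume "w \<in> language \<zeta>"
  then obtain k c ps ss where w: "subst_iter \<zeta> k c = ps @ w @ ss"
    unfolding language_def sublist_def by auto
  obtain p where p: "x p = c" using letter_occurs by blast
  have len: "length ps + length w \<le> q ^ k"
    using arg_cong[OF w, of length] by simp
  have "w ! h = x (q ^ k * p + length ps + h)" if "h < length w" for h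
    using fixed_point_iter_image[of "length ps + h" k p] that len w p
    by (simp add: nth_append add.assoc)
  then have "w = subword x (q ^ k * p + length ps) (q ^ k * p + length ps + length w)"
    unfolding subword_def by (intro nth_equalityI) auto
  then show "\<exists>a. w = subword x a (a + length w)" by blast
next
  assume "\<exists>a. w = subword x a (a + length w)"
  then obtain a where a: "w = subword x a (a + length w)" by blast
  define k where "k = a + length w"
  have k: "a + length w \<le> q ^ k" using less_power[of k] unfolding k_def by simp
  have "subst_iter \<zeta> k 0 = map x [0..<q ^ k]"
    by (intro nth_equalityI) (auto simp: fixed_point_eq)
  also have "[0..<q ^ k] = [0..<a] @ [a..<a + length w] @ [a + length w..<q ^ k]"
    using k upt_add_eq_append[of 0 a "length w"] upt_add_eq_append[of 0 "a + length w" "q ^ k - (a + length w)"]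
    by simp
  finally have "subst_iter \<zeta> k 0 = map x [0..<a] @ w @ map x [a + length w..<q ^ k]"
    using a unfolding subword_def by simp
  then show "w \<in> language \<zeta>" unfolding language_def sublist_def by blast
qed

text \<open>Every prefix of a point of \<open>subst_space \<zeta>\<close> occurs in \<open>x\<close>
  and inherits the period.\<close>

lemma periodic_imp_not_aperiodic:
  assumes "0 < P" "\<And>c. x (c + P) = x c"
  shows "\<not> aperiodic \<zeta>"
proof -
  have "y (i + P) = y i" if y: "y \<in> subst_space \<zeta>" for y i
  proof -
    have "subword y 0 (i + P + 1) \<in> language \<zeta>" using y unfolding subst_space_def by simp
    then obtain a where a: "subword y 0 (i + P + 1) = subword x a (a + (i + P + 1))"
      unfolding language_iff by (auto simp: subword_def)
    have "y h = x (a + h)" if "h < i + P + 1" for h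
      using arg_cong[OF a, of "\<lambda>w. w ! h"] that unfolding subword_def by (simp del: upt_Suc)
    then show ?thesis using assms(2)[of "a + i"] by (simp add: add.assoc)
  qed
  then show ?thesis using assms(1) unfolding aperiodic_def periodic_def by (metis Suc_leI One_nat_def)
qed

lemma aperiodic_imp_images_distinct:
  assumes "aperiodic \<zeta>"
  shows "\<zeta> 0 \<noteq> \<zeta> 1"
proof
  assume eq: "\<zeta> 0 = \<zeta> 1"
  have "\<zeta> a = \<zeta> b" for a b using eq by (cases a; cases b) auto
  then have "x (c + q) = x c" for c
    unfolding fixed_point_at[of c] fixed_point_at[of "c + q"] by (simp, metis)
  then show False using periodic_imp_not_aperiodic[of q] assms by simp
qed

lemma letter_pairs_bounded: "\<exists>B. \<forall>a. \<exists>p\<le>B. x p = x a \<and> x (p + 1) = x (a + 1)"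
proof -
  define pair where "pair a = (x a, x (a + 1))" for a
  have fin: "finite (range pair)"
    by (rule finite_subset[OF subset_UNIV finite_Prod_UNIV]) (rule finite_UNIV_bit)+
  define B where "B = Max ((\<lambda>v. LEAST p. pair p = v) ` range pair)"
  have "\<exists>p\<le>B. pair p = pair a" for a
  proof (intro exI conjI)
    show "(LEAST p. pair p = pair a) \<le> B" unfolding B_def using fin by (intro Max_ge) auto
    show "pair (LEAST p. pair p = pair a) = pair a" by (rule LeastI) simp
  qed
  then show ?thesis unfolding pair_def by blast
qed

text \<open>A word of length \<open>N \<le> q ^ N\<close> lies in the \<open>N\<close>-th image of
  two adjacent letters. All pairs of adjacent letters occur in the prefix of length
  \<open>q ^ m\<close>, which is the \<open>m\<close>-th image of 0, and 0 occurs in every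
  \<open>K\<close>-th image.\<close>

lemma uniformly_recurrent:
  "\<exists>R. \<forall>a b. \<exists>c\<ge>b. c + N \<le> b + R \<and> (\<forall>h<N. x (c + h) = x (a + h))"
proof -
  obtain B where B: "\<And>a. \<exists>p\<le>B. x p = x a \<and> x (p + 1) = x (a + 1)"
    using letter_pairs_bounded by blast
  define m where "m = B + 1"
  have m: "B + 2 \<le> q ^ m" using less_power[of m] unfolding m_def by simp
  obtain K where K: "\<And>a. 0 \<in> set (subst_iter \<zeta> K a)" using primitive unfolding primitive_def by blast
  define Q where "Q = q ^ N * q ^ m * q ^ K"
  have Q0: "0 < Q" unfolding Q_def by simp
  have "\<exists>c\<ge>b. c + N \<le> b + 2 * Q \<and> (\<forall>h<N. x (c + h) = x (a + h))" for a b
  proof -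
    \<comment> \<open>The next multiple of \<open>Q\<close> after \<open>b\<close>; the block of
      length \<open>Q\<close> starting there ends by \<open>b + 2 * Q\<close>.\<close>
    define a' where "a' = b div Q + 1"
    have a': "b \<le> Q * a'" "Q * a' \<le> b + Q"
      unfolding a'_def using Q0 dividend_less_div_times[of Q b] by (auto simp: mult.commute)
    obtain r where r: "r < q ^ K" "subst_iter \<zeta> K (x a') ! r = 0"
      using K by (metis in_set_conv_nth length_subst_iter)
    define s where "s = q ^ K * a' + r"
    have "x s = 0" unfolding s_def using fixed_point_iter_image r by simp
    then have prefix: "x (q ^ m * s + t) = x t" if "t < q ^ m" for t
      using fixed_point_iter_image[OF that] fixed_point_eq[OF that] by simp
    define a1 a2 where "a1 = a div q ^ N" and "a2 = a mod q ^ N"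
    have a: "a = q ^ N * a1 + a2" and a2: "a2 < q ^ N" unfolding a1_def a2_def by simp_all
    have N: "N \<le> q ^ N" using less_power[of N] by simp
    obtain p where p: "p \<le> B" "x p = x a1" "x (p + 1) = x (a1 + 1)" using B by blast
    define p' where "p' = q ^ m * s + p"
    have p': "x (p' + h) = x (a1 + h)" if "h < 2" for h
    proof -
      have "h = 0 \<or> h = 1" using that by auto
      then show ?thesis unfolding p'_def using prefix[of "p + h"] p m that
        by (auto simp: add.assoc)
    qed
    define c where "c = q ^ N * p' + a2"
    have "x (c + h) = x (a + h)" if "h < N" for h
      unfolding c_def a add.assoc by (rule iter_image_cong_word[OF p']) (use a2 N that in auto)
    moreover have "b \<le> c"
    proof -
      have "Q * a' \<le> q ^ N * (q ^ m * s)" unfolding Q_def s_def by (simp add: algebra_simps)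
      then show ?thesis using a' unfolding c_def p'_def by (simp add: algebra_simps)
    qed
    moreover have "c + N \<le> b + 2 * Q"
    proof -
      have "c + N \<le> q ^ N * (p' + 2)" unfolding c_def using a2 N by (simp add: algebra_simps)
      also have "p' + 2 \<le> q ^ m * (s + 1)" unfolding p'_def using p m by simp
      also have "q ^ N * (q ^ m * (s + 1)) \<le> q ^ N * (q ^ m * (q ^ K * (a' + 1)))"
        unfolding s_def using r by (intro mult_le_mono2) simp
      also have "\<dots> = Q * a' + Q" unfolding Q_def by (simp add: algebra_simps)
      finally show ?thesis using a' by simp
    qed
    ultimately show ?thesis by blast
  qed
  then show ?thesis by blast
qed

end

section \<open>Recognizability\<close>

context primitive_subst
begin

text \<open>A long word occurring in two phases contains, by uniform recurrence, the image of a
  prefix of \<open>x\<close>, aligned in one copy and so misaligned in the other. This image is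
  again a prefix of \<open>x\<close>.\<close>

lemma unrecognizable_imp_shifted_prefix:
  assumes "\<And>r. \<exists>i j. (\<forall>h<r. x (i + h) = x (j + h)) \<and> i mod q \<noteq> j mod q"
  shows "\<exists>p. (\<forall>h<N. x (p + h) = x h) \<and> p mod q \<noteq> 0"
proof -
  obtain R where R: "\<And>a b. \<exists>c\<ge>b. c + N \<le> b + R \<and> (\<forall>h<N. x (c + h) = x (a + h))"
    using uniformly_recurrent by blast
  \<comment> \<open>The summand \<open>q\<close> reaches the next block boundary after
    \<open>i\<close>; \<open>q * R\<close> covers the image of a window that holds every word of
    length \<open>N\<close>.\<close>
  obtain i j where ij: "\<And>h. h < q + q * R \<Longrightarrow> x (i + h) = x (j + h)" "i mod q \<noteq> j mod q"
    using assms by blast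
  define b where "b = i div q + 1"
  have b: "i \<le> q * b" "q * b \<le> i + q"
    unfolding b_def using dividend_less_div_times[of q i] by (auto simp: mult.commute)
  obtain c where c: "b \<le> c" "c + N \<le> b + R" "\<And>h. h < N \<Longrightarrow> x (c + h) = x (0 + h)"
    using R by blast
  have iq: "i \<le> q * c" using b mult_le_mono2[OF c(1), of q] by linarith
  have le: "q * c + q * N \<le> q * b + q * R"
    using mult_le_mono2[OF c(2), of q] by (simp add: algebra_simps)
  define p where "p = j + (q * c - i)"
  have "x (p + h) = x h" if "h < N" for h
  proof -
    have "N \<le> q * N" using q_ge_2 by simp
    then have hq: "h < q * N" using that by linarith
    have "x (p + h) = x (i + (q * c - i + h))"
      unfolding p_def add.assoc by (rule ij(1)[symmetric]) (use hq iq le b in linarith)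
    also have "\<dots> = x (q ^ 1 * c + h)" using iq by simp
    also have "\<dots> = x (q ^ 1 * 0 + h)"
      by (rule iter_image_cong_word[where N = N]) (use hq c(3) in auto)
    finally show ?thesis by simp
  qed
  moreover have "p mod q \<noteq> 0"
  proof
    assume "p mod q = 0"
    then obtain u where "p = q * u" by auto
    moreover have "p + i = j + q * c" unfolding p_def using iq by simp
    ultimately have "i + q * u = j + q * c" by simp
    from arg_cong[OF this, of "\<lambda>t. t mod q"] have "i mod q = j mod q" by simp
    then show False using ij(2) by simp
  qed
  ultimately show ?thesis by blast
qed

text \<open>Pigeonhole: if each phase \<open>d\<close> failed at some length \<open>F d\<close>, a
  prefix of length the sum of all \<open>F d\<close> would have no phase left. As
  \<open>k > 0\<close>, the residue modulo \<open>q\<close> survives reduction modulo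
  \<open>q ^ k\<close>.\<close>

lemma shifted_prefix_phase:
  assumes "\<And>N. \<exists>p. (\<forall>h<N. x (p + h) = x h) \<and> p mod q \<noteq> 0" and "0 < k"
  shows "\<exists>d<q ^ k. d mod q \<noteq> 0 \<and> (\<forall>N. \<exists>b. \<forall>h<N. x (q ^ k * b + d + h) = x h)"
proof (rule ccontr)
  assume "\<not> ?thesis"
  then have "\<forall>d. \<exists>N. d < q ^ k \<and> d mod q \<noteq> 0 \<longrightarrow> \<not> (\<exists>b. \<forall>h<N. x (q ^ k * b + d + h) = x h)"
    by blast
  then obtain F where F: "\<And>d. d < q ^ k \<Longrightarrow> d mod q \<noteq> 0 \<Longrightarrow>
      \<not> (\<exists>b. \<forall>h<F d. x (q ^ k * b + d + h) = x h)"
    by metis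
  obtain p where p: "\<And>h. h < (\<Sum>d<q ^ k. F d) \<Longrightarrow> x (p + h) = x h" "p mod q \<noteq> 0"
    using assms(1) by blast
  define d where "d = p mod q ^ k"
  have d: "d < q ^ k" unfolding d_def by simp
  have "d mod q \<noteq> 0"
    unfolding d_def using p(2) assms(2) by (simp add: mod_mod_cancel)
  moreover have "F d \<le> (\<Sum>d<q ^ k. F d)" using d by (intro member_le_sum) auto
  then have "\<forall>h<F d. x (q ^ k * (p div q ^ k) + d + h) = x h"
    unfolding d_def using p(1) by simp
  ultimately show False using F d by blast
qed

text \<open>If recognizability fails, then for every \<open>k\<close> the sequence \<open>x\<close> is the image of points of
  the subshift under a block code of window 2, namely the one that reads off \<open>\<zeta>\<^sup>k\<close>-blocks at an
  offset \<open>d k\<close>. There are finitely many such codes, so two levels share one; iterating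
  it \<open>q\<^sup>l\<close> times shifts by different amounts at the two levels.\<close>

definition code_graph :: "nat \<Rightarrow> nat \<Rightarrow> (bit \<times> bit \<times> bit) set" where
  "code_graph k d = {(x b, x (b + 1), x a) | a b.
     \<forall>r<q ^ k. x (q ^ k * b + d + r) = x (q ^ k * a + r)}"

text \<open>As \<open>d < q ^ k\<close>, a block read at offset \<open>d\<close> meets only the
  images of \<open>x b\<close> and \<open>x (b + 1)\<close>, so a triple of the graph is valid
  wherever its letters occur.\<close>

lemma code_graph_transfer:
  assumes "(x b, x (b + 1), x a) \<in> code_graph k d" "d < q ^ k" "r < q ^ k"
  shows "x (q ^ k * b + d + r) = x (q ^ k * a + r)"
proof -
  obtain a' b' where ab: "x b' = x b" "x (b' + 1) = x (b + 1)" "x a' = x a"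
      "\<forall>r<q ^ k. x (q ^ k * b' + d + r) = x (q ^ k * a' + r)"
    using assms(1) unfolding code_graph_def by auto
  have "x (b + h) = x (b' + h)" if "h < 2" for h
    using ab that by (cases h) auto
  then have "x (q ^ k * b + (d + r)) = x (q ^ k * b' + (d + r))"
    by (rule iter_image_cong_word) (use assms in auto)
  moreover have "x (q ^ k * a' + r) = x (q ^ k * a + r)"
    using ab(3) assms(3) by (intro iter_image_cong) simp
  ultimately show ?thesis using ab(4) assms(3) by (simp add: add.assoc)
qed

text \<open>Each step finds a place \<open>c'\<close> whose letters the code sends to those at
  \<open>c\<close>, and adds one offset. Only level \<open>k\<close> uses \<open>prefix\<close>; the
  equality of the graphs carries the relation over to level \<open>l\<close>.\<close>

lemma iterate_common_code:
  assumes "d < q ^ k" "e < q ^ l" and graph: "code_graph k d = code_graph l e"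
    and prefix: "\<And>N. \<exists>b. \<forall>h<N. x (q ^ k * b + d + h) = x h"
  shows "\<exists>c. \<forall>h<N. x (q ^ k * c + t * d + h) = x h \<and> x (q ^ l * c + t * e + h) = x h"
proof (induction t)
  case 0
  show ?case by (rule exI[of _ 0]) simp
next
  case (Suc t)
  then obtain c where c: "\<And>h. h < N \<Longrightarrow> x (q ^ k * c + t * d + h) = x h"
      "\<And>h. h < N \<Longrightarrow> x (q ^ l * c + t * e + h) = x h"
    by blast
  define L where "L = t * d + t * e + N"
  have L: "L \<le> q ^ m * L" for m using one_le_power[of q m] q_ge_2 by simp
  obtain b where b: "\<And>h. h < q ^ k * c + q ^ k * L \<Longrightarrow> x (q ^ k * b + d + h) = x h"
    using prefix by blast
  \<comment> \<open>At \<open>b\<close> the code reads a prefix of \<open>x\<close>, hence at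
    \<open>b + c\<close> it reads the letters from \<open>c\<close> on.\<close>
  define c' where "c' = b + c"
  have step_k: "x (q ^ k * c' + d + h) = x (q ^ k * c + h)" if "h < q ^ k * L" for h
    using b[of "q ^ k * c + h"] that unfolding c'_def by (simp add: algebra_simps)
  have step_l: "x (q ^ l * c' + e + h) = x (q ^ l * c + h)" if h: "h < q ^ l * L" for h
  proof -
    define i r where "i = h div q ^ l" and "r = h mod q ^ l"
    have i: "i < L" unfolding i_def using h by (simp add: less_mult_imp_div_less mult.commute)
    have r: "r < q ^ l" "h = q ^ l * i + r" unfolding i_def r_def by simp_all
    have "x (q ^ k * (c' + i) + d + s) = x (q ^ k * (c + i) + s)" if "s < q ^ k" for s
    proof -
      have "q ^ k * i + s < q ^ k * (i + 1)" using that by simp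
      also have "\<dots> \<le> q ^ k * L" using i by (intro mult_le_mono2) simp
      finally show ?thesis using step_k[of "q ^ k * i + s"] by (simp add: algebra_simps)
    qed
    then have "(x (c' + i), x (c' + i + 1), x (c + i)) \<in> code_graph k d"
      unfolding code_graph_def mem_Collect_eq
      by (intro exI[of _ "c + i"] exI[of _ "c' + i"] conjI allI impI refl)
    then have "(x (c' + i), x (c' + i + 1), x (c + i)) \<in> code_graph l e" unfolding graph .
    from code_graph_transfer[OF this assms(2) r(1)] show ?thesis
      unfolding r(2) by (simp add: algebra_simps)
  qed
  have "x (q ^ k * c' + Suc t * d + h) = x h" if "h < N" for h
    using step_k[of "t * d + h"] c(1)[OF that] that L[of k] unfolding L_def by (simp add: algebra_simps)
  moreover have "x (q ^ l * c' + Suc t * e + h) = x h" if "h < N" for h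
    using step_l[of "t * e + h"] c(2)[OF that] that L[of l] unfolding L_def by (simp add: algebra_simps)
  ultimately show ?case by blast
qed

text \<open>A window of length \<open>R\<close> on which shifting by \<open>P\<close> changes
  nothing already contains every word of length \<open>P + 1\<close>.\<close>

lemma long_periods_imp_periodic:
  assumes "\<And>N. \<exists>a. \<forall>h<N. x (a + P + h) = x (a + h)"
  shows "x (c + P) = x c"
proof -
  obtain R where R: "\<And>a b. \<exists>c\<ge>b. c + (P + 1) \<le> b + R \<and> (\<forall>h<P + 1. x (c + h) = x (a + h))"
    using uniformly_recurrent by blast
  obtain a where a: "\<And>h. h < R \<Longrightarrow> x (a + P + h) = x (a + h)" using assms by blast
  obtain s where s: "a \<le> s" "s + (P + 1) \<le> a + R" "\<And>h. h < P + 1 \<Longrightarrow> x (s + h) = x (c + h)"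
    using R by blast
  have "x (s + P) = x s" using a[of "s - a"] s(1,2) by (simp add: algebra_simps)
  then show ?thesis using s(3)[of 0] s(3)[of P] by simp
qed

text \<open>After \<open>q ^ Suc l\<close> iterations of a common code both total shifts are
  multiples of the block length. Desubstituting shows long prefixes of \<open>x\<close> at
  \<open>c + m\<close> and at \<open>c + D l\<close>, so the difference is a period of
  \<open>x\<close>.\<close>

lemma recognizability:
  assumes "aperiodic \<zeta>"
  shows "\<exists>r. \<forall>i j. (\<forall>h<r. x (i + h) = x (j + h)) \<longrightarrow> i mod q = j mod q"
proof (rule ccontr)
  assume "\<not> ?thesis"
  then have "\<And>r. \<exists>i j. (\<forall>h<r. x (i + h) = x (j + h)) \<and> i mod q \<noteq> j mod q" by blast
  then have "\<And>N. \<exists>p. (\<forall>h<N. x (p + h) = x h) \<and> p mod q \<noteq> 0"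
    by (rule unrecognizable_imp_shifted_prefix)
  then have "\<forall>k. \<exists>d<q ^ Suc k. d mod q \<noteq> 0 \<and> (\<forall>N. \<exists>b. \<forall>h<N. x (q ^ Suc k * b + d + h) = x h)"
    using shifted_prefix_phase by blast
  then obtain D where D: "\<And>k. D k < q ^ Suc k" "\<And>k. D k mod q \<noteq> 0"
      "\<And>k N. \<exists>b. \<forall>h<N. x (q ^ Suc k * b + D k + h) = x h"
    by metis
  have "finite (UNIV :: (bit \<times> bit \<times> bit) set)"
    by (rule finite_Prod_UNIV finite_UNIV_bit)+
  then have "finite (UNIV :: (bit \<times> bit \<times> bit) set set)"
    by (simp only: Finite_Set.finite_set)
  from finite_subset[OF subset_UNIV this] have "finite (range (\<lambda>k. code_graph (Suc k) (D k)))" .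
  then have "\<not> inj (\<lambda>k. code_graph (Suc k) (D k))"
    using finite_imageD infinite_UNIV_nat by blast
  then obtain k l where kl: "k < l" "code_graph (Suc k) (D k) = code_graph (Suc l) (D l)"
    unfolding inj_def by (metis linorder_neqE_nat)
  define m where "m = q ^ (l - k) * D k"
  have m: "q ^ Suc l * D k = q ^ Suc k * m"
    unfolding m_def using kl(1) by (simp flip: power_add mult.assoc)
  \<comment> \<open>\<open>q\<close> does not divide \<open>D l\<close>, so the period obtained is
    nonzero.\<close>
  have "q dvd m" unfolding m_def using kl(1) by simp
  then have neq: "m \<noteq> D l" using D(2)[of l] by auto
  have shifts: "\<exists>c. \<forall>h<N. x (c + m + h) = x (c + D l + h)" for N
  proof -
    obtain c where c: "\<And>h. h < q ^ Suc l * N \<Longrightarrow> x (q ^ Suc k * c + q ^ Suc l * D k + h) = x h"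
        "\<And>h. h < q ^ Suc l * N \<Longrightarrow> x (q ^ Suc l * c + q ^ Suc l * D l + h) = x h"
      using iterate_common_code[OF D(1) D(1) kl(2) D(3)] by blast
    have le: "q ^ Suc k * N \<le> q ^ Suc l * N" using kl(1) q_ge_2 by (intro mult_le_mono1 power_increasing) auto
    have c1: "x (q ^ Suc k * c + q ^ Suc l * D k + t) = x t" if "t < q ^ Suc k * N" for t
      by (rule c(1)) (use that le in linarith)
    note inj = iter_image_inj[OF aperiodic_imp_images_distinct[OF assms]]
    have "x (c + m + h) = x (0 + h)" if "h < N" for h
      by (rule inj[where k = "Suc k", OF _ that], unfold distrib_left m[symmetric]) (use c1 in simp)
    moreover have "x (c + D l + h) = x (0 + h)" if "h < N" for h
      by (rule inj[where k = "Suc l", OF _ that], unfold distrib_left) (use c(2) in simp)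
    ultimately show ?thesis by metis
  qed
  define P where "P = max m (D l) - min m (D l)"
  have "\<exists>a. \<forall>h<N. x (a + P + h) = x (a + h)" for N
  proof -
    obtain c where c: "\<And>h. h < N \<Longrightarrow> x (c + m + h) = x (c + D l + h)" using shifts by blast
    have "x (c + min m (D l) + P + h) = x (c + min m (D l) + h)" if "h < N" for h
      using c[OF that] unfolding P_def by (cases "m \<le> D l") (auto simp: algebra_simps)
    then show ?thesis by blast
  qed
  then have "x (c + P) = x c" for c by (rule long_periods_imp_periodic)
  moreover have "0 < P" unfolding P_def using neq by auto
  ultimately show False using periodic_imp_not_aperiodic assms by blast
qed

text \<open>\<open>recognizability\<close> provides a number satisfying the condition under the
  \<open>LEAST\<close>, so the constant has its defining property, rephrased here for positions in
  \<open>x\<close>.\<close>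

lemma recognizability_const_props:
  assumes "aperiodic \<zeta>"
  shows "common_prefix_length \<zeta> + common_suffix_length \<zeta> < recognizability_const \<zeta> q"
    and "(\<And>h. h < l \<Longrightarrow> x (i + h) = x (j + h)) \<Longrightarrow> recognizability_const \<zeta> q \<le> l \<Longrightarrow> i mod q = j mod q"
proof -
  define good where "good r \<longleftrightarrow> common_prefix_length \<zeta> + common_suffix_length \<zeta> < r \<and>
    (\<forall>w\<in>language \<zeta>. r \<le> length w \<longrightarrow> recognizable \<zeta> q w)" for r
  obtain r where r: "\<And>i j. (\<forall>h<r. x (i + h) = x (j + h)) \<Longrightarrow> i mod q = j mod q"
    using recognizability[OF assms] by blast
  define r' where "r' = max r (common_prefix_length \<zeta> + common_suffix_length \<zeta> + 1)"
  have "recognizable \<zeta> q w" if w: "w \<in> language \<zeta>" "r' \<le> length w" for w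
  proof -
    obtain a where a: "w = subword x a (a + length w)" using w language_iff by blast
    have "i \<in> {q * m + a mod q | m. True}" if "subword x i (i + length w) = w" for i
    proof -
      have "x (i + h) = x (a + h)" if "h < length w" for h
      proof -
        have "subword x i (i + length w) = subword x a (a + length w)"
          using \<open>subword x i (i + length w) = w\<close> a by (rule trans)
        from arg_cong[OF this, of "\<lambda>u. u ! h"] show ?thesis
          unfolding subword_def using that by simp
      qed
      then have "i mod q = a mod q" using r w(2) unfolding r'_def by simp
      then show ?thesis using mult_div_mod_eq[of q i, symmetric] by auto
    qed
    then have "{i. subword x i (i + length w) = w} \<subseteq> {q * m + a mod q | m. True}" by blast
    moreover have "a mod q < q" by simp
    moreover have "w \<noteq> []" using w(2) unfolding r'_def by auto
    ultimately show ?thesis unfolding recognizable_def using w(1) by blast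
  qed
  then have "good r'" unfolding good_def r'_def by simp
  then have good: "good (recognizability_const \<zeta> q)"
    unfolding recognizability_const_def good_def by (rule LeastI)
  then show "common_prefix_length \<zeta> + common_suffix_length \<zeta> < recognizability_const \<zeta> q"
    unfolding good_def by simp
  assume eq: "\<And>h. h < l \<Longrightarrow> x (i + h) = x (j + h)" and l: "recognizability_const \<zeta> q \<le> l"
  define w where "w = subword x i (i + l)"
  have len: "length w = l" unfolding w_def subword_def by simp
  have "w \<in> language \<zeta>" unfolding language_iff len unfolding w_def by blast
  then have "recognizable \<zeta> q w" using good l len unfolding good_def by simp
  then obtain p where p: "p < q" "{i. subword x i (i + l) = w} \<subseteq> {q * m + p | m. True}"
    unfolding recognizable_def len by blast
  have "subword x j (j + l) = w"
    unfolding w_def subword_def using eq by (intro nth_equalityI) auto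
  then have "\<exists>m. j = q * m + p" "\<exists>m. i = q * m + p" using p(2) unfolding w_def by blast+
  then show "i mod q = j mod q" using p(1) by auto
qed

end

section \<open>Desubstitution of lines\<close>

locale aperiodic_subst = primitive_subst +
  assumes aperiodic: "aperiodic \<zeta>"
begin

abbreviation "\<alpha> \<equiv> common_prefix_length \<zeta>"
abbreviation "\<beta> \<equiv> common_suffix_length \<zeta>"
abbreviation "\<rho> \<equiv> recognizability_const \<zeta> q"

lemmas rho_gt = recognizability_const_props(1)[OF aperiodic]

lemma match_imp_mod_eq:
  assumes "\<And>h. h < l \<Longrightarrow> x (i + h) = x (j + h)" "\<rho> \<le> l"
  shows "i mod q = j mod q"
  using recognizability_const_props(2)[OF aperiodic] assms by blast

definition differ :: "nat \<Rightarrow> bool" where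
  "differ r \<longleftrightarrow> \<zeta> 0 ! r \<noteq> \<zeta> 1 ! r"

lemma differ_iff: "a \<noteq> b \<Longrightarrow> differ r \<longleftrightarrow> \<zeta> a ! r \<noteq> \<zeta> b ! r"
  unfolding differ_def by (cases a; cases b) auto

lemma image_neq_iff:
  assumes "r < q"
  shows "x (q * a + r) \<noteq> x (q * b + r) \<longleftrightarrow> x a \<noteq> x b \<and> differ r"
  using assms differ_iff[of "x a" "x b" r] by (cases "x a = x b") (auto simp: fixed_point_image)

lemma differ_exists: "\<exists>r<q. differ r"
  unfolding differ_def
  using aperiodic_imp_images_distinct[OF aperiodic] nth_equalityI[of "\<zeta> 0" "\<zeta> 1"] by auto

lemma prefix_length_props:
  shows "\<alpha> < q" "differ \<alpha>" "\<And>h. h < \<alpha> \<Longrightarrow> \<not> differ h"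
proof -
  define r where "r = (LEAST r. r < q \<and> differ r)"
  have r: "r < q \<and> differ r" unfolding r_def by (rule LeastI_ex) (rule differ_exists)
  have less: "\<not> differ h" if "h < r" for h
    using not_less_Least[of h "\<lambda>r. r < q \<and> differ r"] that r unfolding r_def by auto
  have "\<alpha> = r"
    unfolding common_prefix_length_def
    by (rule length_longest_common_prefix_least) (use r less in \<open>auto simp: differ_def\<close>)
  then show "\<alpha> < q" "differ \<alpha>" "\<And>h. h < \<alpha> \<Longrightarrow> \<not> differ h" using r less by auto
qed

lemma suffix_length_props:
  shows "\<beta> < q" "differ (q - 1 - \<beta>)" "\<And>h. q - 1 - \<beta> < h \<Longrightarrow> h < q \<Longrightarrow> \<not> differ h"
proof -
  define r where "r = (LEAST r. r < q \<and> differ (q - 1 - r))"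
  have "\<exists>r<q. differ (q - 1 - r)"
  proof -
    obtain r where "r < q" "differ r" using differ_exists by blast
    then show ?thesis by (intro exI[of _ "q - 1 - r"]) auto
  qed
  then have r: "r < q \<and> differ (q - 1 - r)" unfolding r_def by (rule LeastI_ex)
  have less: "\<not> differ (q - 1 - h)" if "h < r" for h
    using not_less_Least[of h "\<lambda>r. r < q \<and> differ (q - 1 - r)"] that r unfolding r_def by auto
  have "\<beta> = r"
    unfolding common_suffix_length_def
    by (rule length_longest_common_prefix_least) (use r less in \<open>auto simp: differ_def rev_nth\<close>)
  moreover have "\<not> differ h" if "q - 1 - r < h" "h < q" for h
    using less[of "q - 1 - h"] that by simp
  ultimately show "\<beta> < q" "differ (q - 1 - \<beta>)" "\<And>h. q - 1 - \<beta> < h \<Longrightarrow> h < q \<Longrightarrow> \<not> differ h"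
    using r by auto
qed

text \<open>\<open>\<alpha>\<close> is the first and \<open>q - 1 - \<beta>\<close> the last
  position where the two images differ.\<close>

lemma prefix_suffix_less: "\<alpha> + \<beta> < q"
proof -
  have "\<not> q - 1 - \<beta> < \<alpha>" using suffix_length_props prefix_length_props by blast
  then show ?thesis using suffix_length_props(1) by linarith
qed

text \<open>The first mismatch of two aligned images lies in the images of the first unequal
  letters, at the first position where these differ.\<close>

lemma desubstitute_right_end:
  assumes "\<And>h. h < e \<Longrightarrow> x (q * a + h) = x (q * b + h)" "x (q * a + e) \<noteq> x (q * b + e)"
  obtains l where "e = q * l + \<alpha>" "\<And>h. h < l \<Longrightarrow> x (a + h) = x (b + h)" "x (a + l) \<noteq> x (b + l)"
proof -
  define l r where "l = e div q" and "r = e mod q"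
  have e: "e = q * l + r" "r < q" unfolding l_def r_def by simp_all
  have neq: "x (a + l) \<noteq> x (b + l) \<and> differ r"
    using assms(2) image_neq_iff[OF e(2), of "a + l" "b + l"] unfolding e(1)
    by (simp add: algebra_simps)
  have no_diff: "x (a + h) = x (b + h)" if "q * h + \<alpha> < e" for h
    using assms(1)[OF that] image_neq_iff[OF prefix_length_props(1), of "a + h" "b + h"]
      prefix_length_props(2) by (auto simp: algebra_simps)
  have "r = \<alpha>"
    using no_diff[of l] neq prefix_length_props(3)[of r] unfolding e(1)
    by (metis linorder_neqE_nat nat_add_left_cancel_less)
  moreover have "x (a + h) = x (b + h)" if "h < l" for h
  proof (rule no_diff)
    have "q * h + q \<le> q * l" using mult_le_mono2[of "h + 1" l q] that by simp
    then show "q * h + \<alpha> < e" using prefix_length_props(1) e(1) by linarith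
  qed
  ultimately show thesis using that e neq by blast
qed

text \<open>Not every line of length at least \<open>\<rho>\<close> comes from a shorter one: it may also lie within a single
  \<open>\<zeta>\<close>-block, strictly between two positions where \<open>\<zeta>(0)\<close> and \<open>\<zeta>(1)\<close> differ.\<close>

definition inner :: "nat \<Rightarrow> nat \<Rightarrow> nat \<Rightarrow> bool" where
  "inner l i j \<longleftrightarrow> (i - 1) mod q = (j - 1) mod q \<and> (j - 1) mod q + l + 1 < q"

text \<open>The mismatch before the match has an offset \<open>r\<close> where the images differ. A
  match that is not inner covers the rest of the block, so \<open>r\<close> is the last such offset;
  this fixes the left end.\<close>

lemma desubstitute_match:
  assumes m: "maximal_match x l i j" and l: "\<rho> \<le> l"
  obtains (inner) "inner l i j"
  | (outer) i' j' l' where "i + \<beta> = q * i'" "j + \<beta> = q * j'" "l = q * l' + \<alpha> + \<beta>" "0 < l'"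
      "maximal_match x l' i' j'"
proof (cases "inner l i j")
  case False
  have match: "\<And>h. h < l \<Longrightarrow> x (i + h) = x (j + h)" and pos: "0 < i" "0 < j"
    using m unfolding maximal_match_def by auto
  have "i mod q = j mod q" using match_imp_mod_eq[OF match l] .
  then have mod: "(i - 1) mod q = (j - 1) mod q"
    using pos q_ge_2 by (cases i; cases j) (auto simp: mod_Suc split: if_splits)
  define a b r where "a = (i - 1) div q" and "b = (j - 1) div q" and "r = (j - 1) mod q"
  have "q * a + r = i - 1" "q * b + r = j - 1"
    unfolding a_def b_def r_def using mod by (metis mult_div_mod_eq)+
  then have i: "i = q * a + r + 1" and j: "j = q * b + r + 1" using pos by simp_all
  have r: "r < q" unfolding r_def by simp
  have "x (q * a + r) \<noteq> x (q * b + r)" using m unfolding maximal_match_def i j by simp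
  then have neq: "x a \<noteq> x b" "differ r" using image_neq_iff[OF r] by auto
  have long: "q \<le> r + l + 1" using False mod unfolding inner_def r_def by simp
  have "\<not> q - 1 - \<beta> < r" using suffix_length_props(3) r neq(2) by blast
  moreover have "\<not> r < q - 1 - \<beta>"
  proof
    assume less: "r < q - 1 - \<beta>"
    then have "x (i + (q - 1 - \<beta> - r - 1)) = x (j + (q - 1 - \<beta> - r - 1))"
      using long by (intro match) simp
    moreover have "i + (q - 1 - \<beta> - r - 1) = q * a + (q - 1 - \<beta>)"
      "j + (q - 1 - \<beta> - r - 1) = q * b + (q - 1 - \<beta>)"
      unfolding i j using less by linarith+
    ultimately have "x (q * a + (q - 1 - \<beta>)) = x (q * b + (q - 1 - \<beta>))" by simp
    then show False
      using image_neq_iff[of "q - 1 - \<beta>" a b] neq(1) suffix_length_props(2) by simp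
  qed
  ultimately have "r + \<beta> + 1 = q" using suffix_length_props(1) by linarith
  then have starts: "i + \<beta> = q * (a + 1)" "j + \<beta> = q * (b + 1)" unfolding i j by simp_all
  have "x (q * (a + 1) + h) = x (q * (b + 1) + h)" if "h < l - \<beta>" for h
    using match[of "\<beta> + h"] that unfolding starts[symmetric] by (simp add: add.assoc)
  moreover have "x (q * (a + 1) + (l - \<beta>)) \<noteq> x (q * (b + 1) + (l - \<beta>))"
    using m l rho_gt unfolding starts[symmetric] maximal_match_def by simp
  ultimately obtain l' where l': "l - \<beta> = q * l' + \<alpha>"
      "\<And>h. h < l' \<Longrightarrow> x (a + 1 + h) = x (b + 1 + h)" "x (a + 1 + l') \<noteq> x (b + 1 + l')"
    using desubstitute_right_end by blast
  have l_eq: "l = q * l' + \<alpha> + \<beta>" using l'(1) l rho_gt by simp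
  \<comment> \<open>\<open>\<rho>\<close> exceeds \<open>\<alpha> + \<beta>\<close> by definition,
    so at least one whole letter remains.\<close>
  then have "0 < l'" using l rho_gt by (cases l') auto
  moreover have "maximal_match x l' (a + 1) (b + 1)"
    unfolding maximal_match_def using l'(2,3) neq by simp
  ultimately show thesis using outer[OF starts l_eq] by simp
qed

text \<open>\<open>l\<close> alone determines the next length \<open>l'\<close>, so all matches of
  length \<open>l\<close> descend together, with common \<open>k\<close>, \<open>s\<close> and
  \<open>m\<close>. The descent stops below \<open>\<rho>\<close> or when only inner matches are
  left.\<close>

lemma reduce_matches:
  assumes "0 < l" "maximal_match x l i\<^sub>0 j\<^sub>0"
  shows "\<exists>k s m. 0 < m \<and> s < q ^ k \<and> l < q ^ k * (m + 1) \<and>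
    (\<forall>i j. maximal_match x l i j \<longrightarrow>
      (\<exists>i' j'. i + s = q ^ k * i' \<and> j + s = q ^ k * j' \<and> maximal_match x m i' j')) \<and>
    (m < \<rho> \<or> (\<forall>i j. maximal_match x m i j \<longrightarrow> inner m i j))"
  using assms
proof (induction l arbitrary: i\<^sub>0 j\<^sub>0 rule: less_induct)
  case (less l)
  show ?case
  proof (cases "l < \<rho> \<or> (\<forall>i j. maximal_match x l i j \<longrightarrow> inner l i j)")
    case True
    then show ?thesis using less.prems(1)
      by (intro exI[of _ "0::nat"] exI[of _ l]) auto
  next
    case False
    then obtain i\<^sub>1 j\<^sub>1 where 1: "maximal_match x l i\<^sub>1 j\<^sub>1" "\<not> inner l i\<^sub>1 j\<^sub>1" by blast
    have l: "\<rho> \<le> l" using False by simp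
    obtain i\<^sub>2 j\<^sub>2 l' where 2: "l = q * l' + \<alpha> + \<beta>" "0 < l'" "maximal_match x l' i\<^sub>2 j\<^sub>2"
      using desubstitute_match[OF 1(1) l] 1(2) by metis
    have "l' < q * l'" using 2(2) q_ge_2 by simp
    then have "l' < l" using 2(1) by linarith
    from less.IH[OF this 2(2,3)] obtain k s m where m: "0 < m" "s < q ^ k" "l' < q ^ k * (m + 1)"
      and red: "\<And>i j. maximal_match x l' i j \<Longrightarrow>
        \<exists>i' j'. i + s = q ^ k * i' \<and> j + s = q ^ k * j' \<and> maximal_match x m i' j'"
      and base: "m < \<rho> \<or> (\<forall>i j. maximal_match x m i j \<longrightarrow> inner m i j)"
      by blast
    define s' where "s' = \<beta> + q * s"
    have "q \<le> l" using 2(1) mult_le_mono2[of 1 l' q] 2(2) by linarith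
    have "\<exists>i' j'. i + s' = q ^ Suc k * i' \<and> j + s' = q ^ Suc k * j' \<and> maximal_match x m i' j'"
      if mm: "maximal_match x l i j" for i j
      using mm l
    proof (cases rule: desubstitute_match)
      \<comment> \<open>A match of length at least \<open>q\<close> does not fit in a block, so once
        one match descends, all do.\<close>
      case inner
      then show ?thesis using \<open>q \<le> l\<close> unfolding inner_def by simp
    next
      case (outer i\<^sub>3 j\<^sub>3 l'')
      then have "l'' = l'" using 2(1) q_ge_2 by simp
      then obtain i' j' where "i\<^sub>3 + s = q ^ k * i'" "j\<^sub>3 + s = q ^ k * j'" "maximal_match x m i' j'"
        using red outer(5) by blast
      moreover have "i + s' = q * (i\<^sub>3 + s)" "j + s' = q * (j\<^sub>3 + s)"
        unfolding s'_def using outer(1,2) by (simp_all add: algebra_simps)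
      ultimately show ?thesis by auto
    qed
    moreover have "s' < q ^ Suc k"
    proof -
      have "s' < q * (s + 1)" unfolding s'_def using suffix_length_props(1) by simp
      also have "\<dots> \<le> q * q ^ k" using m(2) by (intro mult_le_mono2) simp
      finally show ?thesis by simp
    qed
    moreover have "l < q ^ Suc k * (m + 1)"
    proof -
      have "l < q * (l' + 1)" using 2(1) prefix_suffix_less by simp
      also have "\<dots> \<le> q * (q ^ k * (m + 1))" using m(3) by (intro mult_le_mono2) simp
      finally show ?thesis by (simp only: power_Suc mult.assoc)
    qed
    ultimately show ?thesis using m(1) base by blast
  qed
qed

text \<open>Otherwise the mismatch before \<open>j'\<close> has an offset where the images differ,
  in the block of the first match and covered by it, although the letters behind that match are
  unequal.\<close>

lemma inner_matches_separated:
  assumes "maximal_match x m i j" "inner m i j" "maximal_match x m i' j'" "inner m i' j'" "j < j'"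
  shows "j + m < j'"
proof (rule ccontr)
  assume near: "\<not> j + m < j'"
  define d where "d = j' - j"
  have d: "0 < d" "d \<le> m" "j' - 1 = j - 1 + d"
    using near assms(1,5) unfolding d_def maximal_match_def by auto
  define a a' b r where "a = (i - 1) div q" and "a' = (i' - 1) div q" and "b = (j - 1) div q"
    and "r = (j - 1) mod q"
  have ij: "q * a + r = i - 1" "q * b + r = j - 1"
    unfolding a_def b_def r_def using assms(2) unfolding inner_def by (metis mult_div_mod_eq)+
  have rq: "r + d < q" using assms(2) d unfolding inner_def r_def by simp
  have j': "j' - 1 = q * b + (r + d)" using d(3) ij(2) by simp
  have "(i' - 1) mod q = r + d" using assms(4) rq unfolding inner_def j' by simp
  then have i': "i' - 1 = q * a' + (r + d)" unfolding a'_def by (metis mult_div_mod_eq)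
  have "x (q * a' + (r + d)) \<noteq> x (q * b + (r + d))"
    using assms(3) unfolding maximal_match_def i' j' by blast
  then have "differ (r + d)" using image_neq_iff[OF rq] by blast
  moreover have "x a \<noteq> x b"
    using assms(1) image_neq_iff[of r a b] rq unfolding maximal_match_def ij[symmetric] by simp
  ultimately have "x (q * a + (r + d)) \<noteq> x (q * b + (r + d))" using image_neq_iff[OF rq] by blast
  moreover have "d - 1 < m" using d by simp
  then have "x (i + (d - 1)) = x (j + (d - 1))"
    using assms(1) unfolding maximal_match_def by blast
  moreover have "i + (d - 1) = q * a + (r + d)" "j + (d - 1) = q * b + (r + d)"
    using assms(1) ij d unfolding maximal_match_def by linarith+
  ultimately show False by simp
qed

text \<open>By separation the window holds a single \<open>j\<close>; all \<open>i\<close> are below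
  it and congruent to it modulo \<open>q\<close>.\<close>

lemma card_inner_matches_le:
  assumes T: "\<And>i j. (i, j) \<in> T \<Longrightarrow> i < j \<and> j \<le> M + 1 \<and> maximal_match x m i j \<and> inner m i j"
    and window: "\<And>i j i' j'. (i, j) \<in> T \<Longrightarrow> (i', j') \<in> T \<Longrightarrow> j' \<le> j + m"
  shows "q * card T \<le> M"
proof (cases "T = {}")
  case False
  then obtain i\<^sub>0 j\<^sub>0 where 0: "(i\<^sub>0, j\<^sub>0) \<in> T" by auto
  have same: "j = j\<^sub>0" if "(i, j) \<in> T" for i j
    using inner_matches_separated T[OF that] T[OF 0] window[OF that 0] window[OF 0 that]
    by (metis linorder_neqE_nat not_less)
  define g where "g = (\<lambda>(i, j::nat). (i - 1) div q)"
  have mod: "(i - 1) mod q = (j\<^sub>0 - 1) mod q \<and> 0 < i \<and> i < j\<^sub>0" if "(i, j) \<in> T" for i j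
    using T[OF that] same[OF that] unfolding inner_def maximal_match_def by blast
  have "inj_on g T"
  proof (rule inj_onI, clarify)
    fix i j i' j' assume ij: "(i, j) \<in> T" "(i', j') \<in> T" "g (i, j) = g (i', j')"
    then have "(i - 1) div q = (i' - 1) div q" unfolding g_def by simp
    moreover have "(i - 1) mod q = (i' - 1) mod q" using mod[OF ij(1)] mod[OF ij(2)] by simp
    ultimately have "i - 1 = i' - 1" by (metis mult_div_mod_eq)
    then show "i = i' \<and> j = j'"
      using mod[OF ij(1)] mod[OF ij(2)] same[OF ij(1)] same[OF ij(2)] by linarith
  qed
  moreover have "g ` T \<subseteq> {..<(j\<^sub>0 - 1) div q}"
  proof (clarsimp simp: g_def)
    fix i j assume "(i, j) \<in> T"
    then have i: "(i - 1) mod q = (j\<^sub>0 - 1) mod q" "0 < i" "i < j\<^sub>0" using mod by auto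
    then have "q * ((i - 1) div q) < q * ((j\<^sub>0 - 1) div q)"
      using mult_div_mod_eq[of q "i - 1"] mult_div_mod_eq[of q "j\<^sub>0 - 1"] by linarith
    then show "(i - Suc 0) div q < (j\<^sub>0 - Suc 0) div q" by simp
  qed
  ultimately have "card T \<le> (j\<^sub>0 - 1) div q"
    by (metis card_image card_mono finite_lessThan card_lessThan)
  then have "q * card T \<le> q * ((j\<^sub>0 - 1) div q)" by (rule mult_le_mono2)
  also have "\<dots> \<le> j\<^sub>0 - 1" by simp
  finally show ?thesis using T[OF 0] by linarith
qed simp

text \<open>After reduction there are at most \<open>3 * M\<close> matches if
  \<open>m < \<rho>\<close>, where \<open>l \<le> Q * \<rho>\<close>, and at most
  \<open>M div q\<close> inner ones, where \<open>l \<le> Q * q\<close>.\<close>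

lemma card_boundary_matches_le:
  assumes "0 < l"
  shows "l * card {(i, j). i < j \<and> j < n \<and> n \<le> j + l \<and> maximal_match x l i j} \<le> 3 * \<rho> * n"
    (is "l * card ?S \<le> _")
proof (cases "?S = {}")
  case True
  have "card ?S = 0" unfolding True by simp
  then show ?thesis by (simp only: mult_0_right)
next
  case False
  then obtain i\<^sub>0 j\<^sub>0 where 0: "i\<^sub>0 < j\<^sub>0" "j\<^sub>0 < n" "maximal_match x l i\<^sub>0 j\<^sub>0" by auto
  then have n: "2 < n" unfolding maximal_match_def by linarith
  obtain k s m where m: "0 < m" "s < q ^ k" "l < q ^ k * (m + 1)"
    and red: "\<And>i j. maximal_match x l i j \<Longrightarrow>
      \<exists>i' j'. i + s = q ^ k * i' \<and> j + s = q ^ k * j' \<and> maximal_match x m i' j'"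
    and base: "m < \<rho> \<or> (\<forall>i j. maximal_match x m i j \<longrightarrow> inner m i j)"
    using reduce_matches[OF assms 0(3)] by blast
  define Q where "Q = q ^ k"
  have Q: "0 < Q" unfolding Q_def by simp
  define f where "f = (\<lambda>(i, j). ((i + s) div Q, (j + s) div Q))"
  have lift: "\<exists>i' j'. f (i, j) = (i', j') \<and> i + s = Q * i' \<and> j + s = Q * j' \<and> maximal_match x m i' j'"
    if "(i, j) \<in> ?S" for i j
  proof -
    have "maximal_match x l i j" using that by simp
    then obtain i' j' where "i + s = Q * i'" "j + s = Q * j'" "maximal_match x m i' j'"
      using red unfolding Q_def by blast
    then show ?thesis using Q unfolding f_def by simp
  qed
  define T where "T = f ` ?S"
  have finS: "finite ?S" by (rule finite_subset[of _ "{..<n} \<times> {..<n}"]) auto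
  have "inj_on f ?S"
  proof (rule inj_onI)
    fix u v assume uv: "u \<in> ?S" "v \<in> ?S" "f u = f v"
    obtain i j i' j' where [simp]: "u = (i, j)" "v = (i', j')" by (metis surj_pair)
    show "u = v" using lift[of i j] lift[of i' j'] uv by auto
  qed
  then have card: "card T = card ?S" unfolding T_def by (rule card_image)
  \<comment> \<open>From \<open>j \<le> n - 1\<close> and \<open>s \<le> Q - 1\<close> follows
    \<open>j + s \<le> n - 2 + Q\<close>, hence \<open>j' \<le> M + 1\<close>.\<close>
  define M where "M = (n - 2) div Q"
  have QM: "Q * M \<le> n" unfolding M_def using mult_div_mod_eq[of Q "n - 2"] by linarith
  have T: "\<exists>i j. (i, j) \<in> ?S \<and> i + s = Q * i' \<and> j + s = Q * j' \<and> maximal_match x m i' j'"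
    if ij: "(i', j') \<in> T" for i' j'
  proof -
    obtain u where u: "(i', j') = f u" "u \<in> ?S" using ij unfolding T_def by (rule imageE)
    obtain i j where [simp]: "u = (i, j)" by (metis surj_pair)
    have S: "(i, j) \<in> ?S" using u(2) unfolding \<open>u = (i, j)\<close> .
    obtain i'' j'' where 1: "f (i, j) = (i'', j'')" "i + s = Q * i''" "j + s = Q * j''"
        "maximal_match x m i'' j''"
      using lift[OF S] by blast
    then have "i'' = i'" "j'' = j'" using u(1) by auto
    then show ?thesis using S 1 by blast
  qed
  have T1: "i' < j' \<and> j' \<le> M + 1 \<and> maximal_match x m i' j'" if in_T: "(i', j') \<in> T" for i' j'
  proof -
    obtain i j where ij: "(i, j) \<in> ?S" "i + s = Q * i'" "j + s = Q * j'" "maximal_match x m i' j'"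
      using T[OF in_T] by blast
    then have "i < j" by simp
    then have "i + s < j + s" by simp
    then have "Q * i' < Q * j'" unfolding ij(2,3) .
    moreover have "Q * j' \<le> n - 2 + Q" using ij m(2) n unfolding Q_def by auto
    then have "Q * j' div Q \<le> (n - 2 + Q) div Q" by (rule div_le_mono)
    then have "j' \<le> M + 1" unfolding M_def using Q by simp
    ultimately show ?thesis using ij(4) Q by simp
  qed
  have window: "j2 \<le> j1 + m" if in_T: "(i1, j1) \<in> T" "(i2, j2) \<in> T" for i1 j1 i2 j2
  proof -
    obtain i j where "(i, j) \<in> ?S" "j + s = Q * j1" using T[OF in_T(1)] by blast
    moreover obtain i' j' where "(i', j') \<in> ?S" "j' + s = Q * j2" using T[OF in_T(2)] by blast
    \<comment> \<open>Two values of \<open>j\<close> among the last \<open>l\<close> positions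
      before \<open>n\<close> differ by less than \<open>l\<close>.\<close>
    ultimately have "Q * j2 < Q * j1 + l" by auto
    also have "\<dots> < Q * (j1 + m + 1)" using m(3) unfolding Q_def by (simp add: algebra_simps)
    finally have "j2 < j1 + m + 1" by (simp only: mult_less_cancel1)
    then show ?thesis by simp
  qed
  show ?thesis
    using base
  proof
    assume "m < \<rho>"
    then have "l \<le> Q * \<rho>" using m(3) mult_le_mono2[of "m + 1" \<rho> Q] unfolding Q_def by linarith
    moreover have "card T \<le> 3 * M"
      by (rule card_maximal_matches_le[OF _ T1 window]) (use finS T_def in auto)
    ultimately have "l * card ?S \<le> (Q * \<rho>) * (3 * M)" unfolding card by (rule mult_le_mono)
    also have "\<dots> = 3 * \<rho> * (Q * M)" by simp
    also have "\<dots> \<le> 3 * \<rho> * n" using QM by (rule mult_le_mono2)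
    finally show ?thesis .
  next
    assume inner: "\<forall>i j. maximal_match x m i j \<longrightarrow> inner m i j"
    obtain i' j' where "maximal_match x m i' j'" using lift[of i\<^sub>0 j\<^sub>0] red[OF 0(3)] by blast
    then have "m + 1 \<le> q" using inner unfolding inner_def by fastforce
    then have "l \<le> Q * q" using m(3) mult_le_mono2[of "m + 1" q Q] unfolding Q_def by linarith
    then have "l * card ?S \<le> Q * q * card T" unfolding card by (rule mult_le_mono1)
    also have "\<dots> \<le> Q * M"
      unfolding mult.assoc by (intro mult_le_mono2 card_inner_matches_le[where m = m])
        (use T1 inner window in blast)+
    also have "\<dots> \<le> 3 * \<rho> * n"
      using QM rho_gt by (intro order_trans[OF QM]) simp
    finally show ?thesis .
  qed
qed

section \<open>Lines on the border of the matrix\<close>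

definition initial_match :: "nat \<Rightarrow> nat \<Rightarrow> bool" where
  "initial_match l j \<longleftrightarrow> 0 < j \<and> (\<forall>h<l. x h = x (j + h)) \<and> x l \<noteq> x (j + l)"

text \<open>Matching the beginning of \<open>x\<close> forces \<open>q\<close> to divide
  \<open>j\<close>. The left end stays aligned, so neither \<open>\<beta>\<close> nor inner matches
  enter.\<close>

lemma reduce_initial_matches:
  assumes "initial_match l j\<^sub>0"
  shows "\<exists>k. l < q ^ k * \<rho> \<and> (\<forall>j. initial_match l j \<longrightarrow> q ^ k dvd j)"
  using assms
proof (induction l arbitrary: j\<^sub>0 rule: less_induct)
  case (less l)
  show ?case
  proof (cases "l < \<rho>")
    case True
    then show ?thesis by (intro exI[of _ 0]) simp
  next
    case False
    have step: "\<exists>l' j'. j = q * j' \<and> l = q * l' + \<alpha> \<and> initial_match l' j'" if j: "initial_match l j" for j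
    proof -
      have "0 mod q = j mod q"
        by (rule match_imp_mod_eq[of l]) (use j False in \<open>auto simp: initial_match_def\<close>)
      then obtain j' where j': "j = q * j'" by auto
      obtain l' where "l = q * l' + \<alpha>" "\<And>h. h < l' \<Longrightarrow> x (0 + h) = x (j' + h)"
          "x (0 + l') \<noteq> x (j' + l')"
        by (rule desubstitute_right_end[of l 0 j']) (use j in \<open>auto simp: initial_match_def j'\<close>)
      then show ?thesis using j j' unfolding initial_match_def by auto
    qed
    obtain l' j' where l': "l = q * l' + \<alpha>" "initial_match l' j'" using step[OF less.prems] by blast
    have "l' < l"
    proof (cases "l' = 0")
      case True
      then show ?thesis using False rho_gt by simp
    next
      case nz: False
      then have "l' < q * l'" using q_ge_2 by simp
      then show ?thesis using l'(1) by linarith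
    qed
    then obtain k where k: "l' < q ^ k * \<rho>" "\<And>j. initial_match l' j \<Longrightarrow> q ^ k dvd j"
      using less.IH l'(2) by blast
    have "q ^ Suc k dvd j" if j: "initial_match l j" for j
    proof -
      obtain l'' j'' where 3: "j = q * j''" "l = q * l'' + \<alpha>" "initial_match l'' j''"
        using step[OF j] by blast
      then have "l'' = l'" using l'(1) q_ge_2 by simp
      then have "q ^ k dvd j''" using k(2) 3(3) by blast
      then show ?thesis unfolding 3(1) by simp
    qed
    moreover have "l < q ^ Suc k * \<rho>"
    proof -
      have "l < q * (l' + 1)" using l'(1) prefix_length_props(1) by simp
      also have "\<dots> \<le> q * (q ^ k * \<rho>)" using k(1) by (intro mult_le_mono2) simp
      finally show ?thesis by (simp add: mult.assoc)
    qed
    ultimately show ?thesis by blast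
  qed
qed

text \<open>The positions are positive multiples of \<open>q ^ k\<close> below \<open>n\<close>.
  Passing from \<open>n - 1\<close> to \<open>n\<close> gives the strict inequality.\<close>

lemma card_initial_matches_less:
  assumes "0 < n"
  shows "l * card {j. j < n \<and> initial_match l j} < \<rho> * n" (is "l * card ?W < _")
proof (cases "?W = {}")
  case True
  have "card ?W = 0" unfolding True by simp
  moreover have "0 < \<rho> * n" using assms rho_gt by simp
  ultimately show ?thesis by (simp only: mult_0_right)
next
  case False
  then obtain j\<^sub>0 where "initial_match l j\<^sub>0" by blast
  then obtain k where k: "l < q ^ k * \<rho>" "\<And>j. initial_match l j \<Longrightarrow> q ^ k dvd j"
    using reduce_initial_matches by blast
  define Q where "Q = q ^ k"
  have Q: "0 < Q" unfolding Q_def by simp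
  have "?W \<subseteq> (\<lambda>t. Q * t) ` {1..(n - 1) div Q}"
  proof
    fix j assume j: "j \<in> ?W"
    then obtain t where t: "j = Q * t" using k(2) unfolding Q_def by blast
    have "0 < t" using j unfolding t initial_match_def by (cases t) auto
    moreover have "t \<le> (n - 1) div Q"
      using j Q unfolding t by (auto simp: less_eq_div_iff_mult_less_eq mult.commute)
    ultimately show "j \<in> (\<lambda>t. Q * t) ` {1..(n - 1) div Q}" unfolding t by (intro imageI) simp
  qed
  then have "card ?W \<le> (n - 1) div Q"
    by (metis (no_types, lifting) surj_card_le finite_atLeastAtMost card_atLeastAtMost diff_Suc_1)
  then have "l * card ?W \<le> (Q * \<rho>) * ((n - 1) div Q)"
    using k(1) unfolding Q_def by (intro mult_le_mono) auto
  also have "\<dots> = \<rho> * (Q * ((n - 1) div Q))" by simp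
  also have "\<dots> \<le> \<rho> * (n - 1)" by (intro mult_le_mono2) simp
  also have "\<dots> < \<rho> * n" using assms rho_gt by simp
  finally show ?thesis .
qed

end

section \<open>From boundary lines to matches\<close>

lemma is_line_infinite_iff:
  "is_line x \<infinity> i j l \<longleftrightarrow> 0 < l \<and> i \<noteq> j \<and> (\<forall>h<l. x (i + h) = x (j + h)) \<and>
    (0 < i \<and> 0 < j \<longrightarrow> x (i - 1) \<noteq> x (j - 1)) \<and> x (i + l) \<noteq> x (j + l)"
  unfolding is_line_def recurrence_def by auto

lemma is_line_infinite_commute: "is_line x \<infinity> i j l \<longleftrightarrow> is_line x \<infinity> j i l"
  unfolding is_line_infinite_iff by metis

text \<open>\<open>0 < l\<close> excludes the default value of \<open>line_length\<close>, and the
  first mismatch determines the length, so the \<open>THE\<close> is proper.\<close>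

lemma line_length_infinite_eqD:
  assumes "line_length x \<infinity> i j = l" "0 < l"
  shows "is_line x \<infinity> i j l"
proof -
  obtain m where m: "is_line x \<infinity> i j m"
    using assms unfolding line_length_def by (auto split: if_splits)
  have "m' = m" if "is_line x \<infinity> i j m'" for m'
    using m that unfolding is_line_infinite_iff by (metis linorder_neqE_nat)
  with m have "(THE m. is_line x \<infinity> i j m) = m" by blast
  then show ?thesis using assms m unfolding line_length_def by auto
qed

text \<open>Cutting at \<open>n\<close> shortens a line of length \<open>l\<close> to some
  \<open>m \<le> l\<close> with \<open>max i j + m = n\<close>, so \<open>max i j\<close> is among
  the last \<open>l\<close> positions. The third component depends on \<open>i\<close> and
  \<open>j\<close> only.\<close>

lemma boundary_count_le:
  assumes "0 < l"
  shows "boundary_count x l n \<le>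
    card {(i, j). max i j < n \<and> n \<le> max i j + l \<and> is_line x \<infinity> i j l}" (is "_ \<le> card ?P")
proof -
  have "{(i, j, line_length x (enat n) i j) | i j.
      boundary_line x n i j (line_length x (enat n) i j) \<and> line_length x \<infinity> i j = l}
    \<subseteq> (\<lambda>(i, j). (i, j, line_length x (enat n) i j)) ` ?P"
  proof
    fix t
    assume "t \<in> {(i, j, line_length x (enat n) i j) | i j.
      boundary_line x n i j (line_length x (enat n) i j) \<and> line_length x \<infinity> i j = l}"
    then obtain i j where t: "t = (i, j, line_length x (enat n) i j)"
      and b: "boundary_line x n i j (line_length x (enat n) i j)" and l: "line_length x \<infinity> i j = l"
      by blast
    define m where "m = line_length x (enat n) i j"
    have m: "is_line x (enat n) i j m" "max i j + m = n"
      using b unfolding boundary_line_def m_def by auto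
    have inf: "is_line x \<infinity> i j l" using line_length_infinite_eqD l assms by blast
    have "x (i + h) = x (j + h)" if "h < m" for h
      using m(1) that unfolding is_line_def recurrence_def by (metis zero_neq_one)
    then have "m \<le> l" using inf unfolding is_line_infinite_iff by (metis not_less)
    moreover have "0 < m" using m(1) unfolding is_line_def by simp
    ultimately have "(i, j) \<in> ?P" using m(2) inf by auto
    then show "t \<in> (\<lambda>(i, j). (i, j, line_length x (enat n) i j)) ` ?P"
      unfolding t by (intro image_eqI[of _ _ "(i, j)"]) auto
  qed
  moreover have "finite ?P" by (rule finite_subset[of _ "{..<n} \<times> {..<n}"]) auto
  ultimately show ?thesis unfolding boundary_count_def by (rule surj_card_le[rotated])
qed

theorem proposition4p3:
  fixes \<zeta> :: substitution and q n l :: nat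
  assumes "q \<ge> 2"
    and "constant_length \<zeta> q"
    and "primitive \<zeta>"
    and "aperiodic \<zeta>"
    and "hd (\<zeta> 0) = 0"
    and "n \<ge> 2"
    and "l \<ge> 1"
  shows "l * boundary_count (fixed_point \<zeta>) l n < 8 * recognizability_const \<zeta> q * n"
proof -
  interpret aperiodic_subst \<zeta> q by unfold_locales (fact assms)+
  have l: "0 < l" and n: "0 < n" using assms by simp_all
  define S where "S = {(i, j). i < j \<and> j < n \<and> n \<le> j + l \<and> maximal_match x l i j}"
  define W where "W = {j. j < n \<and> initial_match l j}"
  define P where "P = {(i, j). max i j < n \<and> n \<le> max i j + l \<and> is_line x \<infinity> i j l}"
  \<comment> \<open>\<open>U\<close> covers the half \<open>i < j\<close> of \<open>P\<close>;
    transposition gives the other half, whence the factor 2.\<close>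
  define U where "U = S \<union> {0} \<times> W"
  have fin: "finite U"
    by (rule finite_subset[of _ "{..<n} \<times> {..<n}"]) (auto simp: U_def S_def W_def)
  have cardU: "card U \<le> card S + card W"
    unfolding U_def using card_Un_le[of S "{0} \<times> W"] by (simp add: card_cartesian_product)
  have lower: "(i, j) \<in> U" if "(i, j) \<in> P" "i < j" for i j
    using that unfolding P_def U_def S_def W_def is_line_infinite_iff maximal_match_def initial_match_def
    by (cases "i = 0") auto
  have "P \<subseteq> U \<union> prod.swap ` U"
  proof (rule subrelI)
    fix i j assume ij: "(i, j) \<in> P"
    show "(i, j) \<in> U \<union> prod.swap ` U"
    proof (cases "i < j")
      case True
      then show ?thesis using lower[OF ij] by simp
    next
      case False
      have "i \<noteq> j" using ij unfolding P_def is_line_infinite_iff by blast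
      moreover have "(j, i) \<in> P"
        using ij is_line_infinite_commute[of x i j l] unfolding P_def by (simp add: max.commute)
      ultimately have "(j, i) \<in> U" using False lower by simp
      then show ?thesis using image_eqI[of "(i, j)" prod.swap "(j, i)" U] by simp
    qed
  qed
  then have "card P \<le> card (U \<union> prod.swap ` U)" using fin by (intro card_mono) auto
  also have "\<dots> \<le> card U + card (prod.swap ` U)" by (rule card_Un_le)
  also have "\<dots> \<le> 2 * card U" using card_image_le[OF fin, of prod.swap] by simp
  finally have "card P \<le> 2 * (card S + card W)" using cardU by simp
  then have "boundary_count x l n \<le> 2 * (card S + card W)"
    using boundary_count_le[OF l, of x n] unfolding P_def by simp
  then have "l * boundary_count x l n \<le> l * (2 * (card S + card W))" by (rule mult_le_mono2)
  also have "\<dots> = 2 * (l * card S + l * card W)" by (simp add: algebra_simps)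
  \<comment> \<open>The constant is \<open>2 * (3 + 1) = 8\<close>; strictness comes from the border
    lines.\<close>
  also have "\<dots> < 2 * (3 * \<rho> * n + \<rho> * n)"
    using add_le_less_mono[OF card_boundary_matches_le[OF l, of n] card_initial_matches_less[OF n, of l]]
    unfolding S_def W_def mult_less_cancel1 by simp
  finally show ?thesis by (simp add: algebra_simps)
qed

end
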